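(* (In $\mathbf{ZF}$.) Let $\mathbf{E}$ be a Tychonoff space such that $\mathbb{R}_{disc}$ is $\mathbf{E}$-compact. Let $\mathbf{X}$ be an $\mathbf{E}$-completely regular $P$-space. Then $\mathbf{CMC}$ implies that $v_{\mathbf{E}}\mathbf{X}$ is a $P$-space.
   Context: The base theory is $\mathbf{ZF}$ (the Axiom of Choice is not assumed). $\mathbf{CMC}$ is the statement: for every family $\{A_n:n\in\omega\}$ of non-empty sets there is a function assigning to each $n\in\omega$ a non-empty finite subset of $A_n$. $\mathbb{R}_{disc}$ is $\mathbb{R}$ with the discrete topology. A space is Tychonoff if it is $T_1$ and the complements of zero-sets of continuous real functions form a base. A space is a $P$-space if the family of all its $G_\delta$-sets is equal to its topology, i.e. every $G_\delta$-set is open. A space is $\mathbf{E}$-completely regular (respectively, $\mathbf{E}$-compact) if for some non-empty set $J$ it is homeomorphic with a subspace (respectively, closed subspace) of the product $\mathbf{E}^J$. An extension of $\mathbf{X}$ is a pair $\langle\mathbf{Y},h\rangle$ with $h:\mathbf{X}\to\mathbf{Y}$ a homeomorphic embedding with dense image. For a Hausdorff space $\mathbf{E}$ and an $\mathbf{E}$-completely regular space $\mathbf{X}$, $v_{\mathbf{E}}\mathbf{X}$ is the Hewitt $\mathbf{E}$-compact extension of $\mathbf{X}$: the extension $\langle\mathbf{Y},h\rangle$ with $\mathbf{Y}$ $\mathbf{E}$-compact such that for every continuous $f:\mathbf{X}\to\mathbf{E}$ there is a continuous $\tilde f:\mathbf{Y}\to\mathbf{E}$ with $\tilde f\circ h=f$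 (it exists in $\mathbf{ZF}$ and is unique up to a homeomorphism commuting with the embeddings). *)

theory Defs
  imports "HOL-Algebra.Ring"
begin

text \<open>
  HOL has a choice operator, so \<^bold>\<open>CMC\<close> would be vacuous if it were stated about HOL sets. Choice-free
  mathematics is therefore done inside an arbitrary model \<open>('v, mem)\<close> of first-order ZF. As \<open>'v\<close> and \<open>mem\<close>
  are arbitrary, truth in all these models is the same as provability in ZF, by completeness.
  Everything below is relative to the model: variables of type \<open>'v\<close> are the sets of the model, while
  HOL sets of type \<open>'v set\<close> serve only as notation for classes. Each notion quantifies over
  elements of \<open>'v\<close> alone, never over arbitrary classes or arbitrary HOL functions.
\<close>

datatype fm = FMem nat nat | FEq nat nat | FNeg fm | FConj fm fm | FAll nat fm

primrec sat :: "('v \<Rightarrow> 'v \<Rightarrow> bool) \<Rightarrow> (nat \<Rightarrow> 'v) \<Rightarrow> fm \<Rightarrow> bool" where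
  "sat mem s (FMem i j) \<longleftrightarrow> mem (s i) (s j)"
| "sat mem s (FEq i j) \<longleftrightarrow> s i = s j"
| "sat mem s (FNeg p) \<longleftrightarrow> \<not> sat mem s p"
| "sat mem s (FConj p q) \<longleftrightarrow> sat mem s p \<and> sat mem s q"
| "sat mem s (FAll i p) \<longleftrightarrow> (\<forall>x. sat mem (s(i := x)) p)"

datatype 'v space = Space (pts: 'v) (opens: 'v)

text \<open>The data of an ordered field of the model; the operations and the order are sets of the model.\<close>

datatype 'v ofield =
  OField (fcarrier: 'v) (fadd: 'v) (fmult: 'v) (fzero: 'v) (fone: 'v) (fless: 'v)

locale set_universe =
  fixes mem :: "'v \<Rightarrow> 'v \<Rightarrow> bool"
begin

definition elems :: "'v \<Rightarrow> 'v set" where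
  "elems a = {x. mem x a}"

text \<open>The set of the model with the given elements; meaningful only when there is one.\<close>

definition code :: "'v set \<Rightarrow> 'v" where
  "code A = (THE a. elems a = A)"

definition opair :: "'v \<Rightarrow> 'v \<Rightarrow> 'v" where
  "opair x y = code {code {x}, code {x, y}}"

definition cprod :: "'v \<Rightarrow> 'v \<Rightarrow> 'v" where
  "cprod a b = code {opair x y | x y. x \<in> elems a \<and> y \<in> elems b}"

definition pow :: "'v \<Rightarrow> 'v" where
  "pow a = code {b. elems b \<subseteq> elems a}"

definition funs :: "'v \<Rightarrow> 'v \<Rightarrow> 'v set" where
  "funs a b = {f. elems f \<subseteq> elems (cprod a b) \<and> (\<forall>x\<in>elems a. \<exists>!y. opair x y \<in> elems f)}"

definition app :: "'v \<Rightarrow> 'v \<Rightarrow> 'v" where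
  "app f x = (THE y. opair x y \<in> elems f)"

definition image_set :: "'v \<Rightarrow> 'v \<Rightarrow> 'v" where
  "image_set f a = code (app f ` elems a)"

definition is_inductive :: "'v \<Rightarrow> bool" where
  "is_inductive w \<longleftrightarrow>
     code {} \<in> elems w \<and> (\<forall>x\<in>elems w. code (insert x (elems x)) \<in> elems w)"

definition omega :: 'v where
  "omega = code {n. \<forall>w. is_inductive w \<longrightarrow> n \<in> elems w}"

text \<open>Finiteness in the sense of the model. The \<open>\<omega>\<close> of the model may be nonstandard, so this is
  weaker than HOL finiteness of \<open>elems a\<close>.\<close>

definition is_finite :: "'v \<Rightarrow> bool" where
  "is_finite a \<longleftrightarrow> (\<exists>n\<in>elems omega. \<exists>f\<in>funs n a. bij_betw (app f) (elems n) (elems a))"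

definition CMC :: bool where
  "CMC \<longleftrightarrow> (\<forall>B. \<forall>A\<in>funs omega B. (\<forall>n\<in>elems omega. elems (app A n) \<noteq> {}) \<longrightarrow>
     (\<exists>C. \<exists>F\<in>funs omega C. \<forall>n\<in>elems omega.
        elems (app F n) \<subseteq> elems (app A n) \<and> elems (app F n) \<noteq> {} \<and> is_finite (app F n)))"

definition top_space :: "'v space \<Rightarrow> bool" where
  "top_space X \<longleftrightarrow>
     (\<forall>U\<in>elems (opens X). elems U \<subseteq> elems (pts X)) \<and>
     code {} \<in> elems (opens X) \<and> pts X \<in> elems (opens X) \<and>
     (\<forall>U\<in>elems (opens X). \<forall>V\<in>elems (opens X). code (elems U \<inter> elems V) \<in> elems (opens X)) \<and>
     (\<forall>S. elems S \<subseteq> elems (opens X) \<longrightarrow> code (\<Union>U\<in>elems S. elems U) \<in> elems (opens X))"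

definition discrete :: "'v \<Rightarrow> 'v space" where
  "discrete a = Space a (pow a)"

definition subspace :: "'v space \<Rightarrow> 'v \<Rightarrow> 'v space" where
  "subspace X s = Space s (code ((\<lambda>U. code (elems U \<inter> elems s)) ` elems (opens X)))"

definition closed_in :: "'v space \<Rightarrow> 'v \<Rightarrow> bool" where
  "closed_in X s \<longleftrightarrow>
     elems s \<subseteq> elems (pts X) \<and> code (elems (pts X) - elems s) \<in> elems (opens X)"

definition dense_in :: "'v space \<Rightarrow> 'v \<Rightarrow> bool" where
  "dense_in X s \<longleftrightarrow> elems s \<subseteq> elems (pts X) \<and>
     (\<forall>U\<in>elems (opens X). elems U \<noteq> {} \<longrightarrow> elems U \<inter> elems s \<noteq> {})"

definition cmaps :: "'v space \<Rightarrow> 'v space \<Rightarrow> 'v set" where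
  "cmaps X Y = {f\<in>funs (pts X) (pts Y).
     \<forall>V\<in>elems (opens Y). code {x\<in>elems (pts X). app f x \<in> elems V} \<in> elems (opens X)}"

definition homeomorphism :: "'v \<Rightarrow> 'v space \<Rightarrow> 'v space \<Rightarrow> bool" where
  "homeomorphism h X Y \<longleftrightarrow> h \<in> cmaps X Y \<and>
     (\<exists>g\<in>cmaps Y X. (\<forall>x\<in>elems (pts X). app g (app h x) = x) \<and>
                     (\<forall>y\<in>elems (pts Y). app h (app g y) = y))"

text \<open>The space \<open>E\<^sup>J\<close>, with the coarsest topology that makes all projections continuous.\<close>

definition power_space :: "'v space \<Rightarrow> 'v \<Rightarrow> 'v space" where
  "power_space E J = (let P = code (funs J (pts E)) in
     Space P (code {W. \<forall>T. top_space (Space P T) \<and>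
        (\<forall>j\<in>elems J. \<forall>U\<in>elems (opens E). code {f\<in>elems P. app f j \<in> elems U} \<in> elems T)
        \<longrightarrow> W \<in> elems T}))"

definition E_completely_regular :: "'v space \<Rightarrow> 'v space \<Rightarrow> bool" where
  "E_completely_regular E X \<longleftrightarrow> top_space X \<and>
     (\<exists>J S h. elems J \<noteq> {} \<and> elems S \<subseteq> elems (pts (power_space E J)) \<and>
        homeomorphism h X (subspace (power_space E J) S))"

definition E_compact :: "'v space \<Rightarrow> 'v space \<Rightarrow> bool" where
  "E_compact E X \<longleftrightarrow> top_space X \<and>
     (\<exists>J S h. elems J \<noteq> {} \<and> closed_in (power_space E J) S \<and>
        homeomorphism h X (subspace (power_space E J) S))"

definition extension :: "'v space \<Rightarrow> 'v space \<Rightarrow> 'v \<Rightarrow> bool" where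
  "extension X Y h \<longleftrightarrow> top_space Y \<and> h \<in> funs (pts X) (pts Y) \<and>
     homeomorphism h X (subspace Y (image_set h (pts X))) \<and>
     dense_in Y (image_set h (pts X))"

definition Hewitt_extension :: "'v space \<Rightarrow> 'v space \<Rightarrow> 'v space \<Rightarrow> 'v \<Rightarrow> bool" where
  "Hewitt_extension E X Y h \<longleftrightarrow> extension X Y h \<and> E_compact E Y \<and>
     (\<forall>f\<in>cmaps X E. \<exists>g\<in>cmaps Y E. \<forall>x\<in>elems (pts X). app g (app h x) = app f x)"

definition G_delta :: "'v space \<Rightarrow> 'v \<Rightarrow> bool" where
  "G_delta X A \<longleftrightarrow>
     (\<exists>g\<in>funs omega (opens X). elems A = (\<Inter>n\<in>elems omega. elems (app g n)))"

definition P_space :: "'v space \<Rightarrow> bool" where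
  "P_space X \<longleftrightarrow> top_space X \<and> {A. G_delta X A} = elems (opens X)"

definition ring_of :: "'v ofield \<Rightarrow> 'v ring" where
  "ring_of R = \<lparr>carrier = elems (fcarrier R),
     monoid.mult = (\<lambda>x y. app (fmult R) (opair x y)), one = fone R,
     zero = fzero R, add = (\<lambda>x y. app (fadd R) (opair x y))\<rparr>"

definition less_of :: "'v ofield \<Rightarrow> 'v \<Rightarrow> 'v \<Rightarrow> bool" where
  "less_of R x y \<longleftrightarrow> opair x y \<in> elems (fless R)"

text \<open>\<open>R\<close> is the field of real numbers of the model, i.e. (up to isomorphism) its complete ordered
  field. The bounded sets \<open>S\<close> required to have suprema are sets of the model.\<close>

definition real_numbers :: "'v ofield \<Rightarrow> bool" where
  "real_numbers R \<longleftrightarrow>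
     fadd R \<in> funs (cprod (fcarrier R) (fcarrier R)) (fcarrier R) \<and>
     fmult R \<in> funs (cprod (fcarrier R) (fcarrier R)) (fcarrier R) \<and>
     elems (fless R) \<subseteq> elems (cprod (fcarrier R) (fcarrier R)) \<and>
     field (ring_of R) \<and>
     (\<forall>x\<in>elems (fcarrier R). \<not> less_of R x x) \<and>
     (\<forall>x\<in>elems (fcarrier R). \<forall>y\<in>elems (fcarrier R). x = y \<or> less_of R x y \<or> less_of R y x) \<and>
     (\<forall>x\<in>elems (fcarrier R). \<forall>y\<in>elems (fcarrier R). \<forall>z\<in>elems (fcarrier R).
        (less_of R x y \<and> less_of R y z \<longrightarrow> less_of R x z) \<and>
        (less_of R x y \<longrightarrow> less_of R (x \<oplus>\<^bsub>ring_of R\<^esub> z) (y \<oplus>\<^bsub>ring_of R\<^esub> z)) \<and>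
        (less_of R x y \<and> less_of R (fzero R) z \<longrightarrow>
           less_of R (x \<otimes>\<^bsub>ring_of R\<^esub> z) (y \<otimes>\<^bsub>ring_of R\<^esub> z))) \<and>
     (\<forall>S. elems S \<subseteq> elems (fcarrier R) \<and> elems S \<noteq> {} \<and>
        (\<exists>b\<in>elems (fcarrier R). \<forall>x\<in>elems S. \<not> less_of R b x) \<longrightarrow>
        (\<exists>b\<in>elems (fcarrier R). (\<forall>x\<in>elems S. \<not> less_of R b x) \<and>
           (\<forall>c\<in>elems (fcarrier R). (\<forall>x\<in>elems S. \<not> less_of R c x) \<longrightarrow> \<not> less_of R c b)))"

definition real_line :: "'v ofield \<Rightarrow> 'v space" where
  "real_line R = Space (fcarrier R) (code {V. elems V \<subseteq> elems (fcarrier R) \<and>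
     (\<forall>x\<in>elems V. \<exists>a\<in>elems (fcarrier R). \<exists>b\<in>elems (fcarrier R).
        less_of R a x \<and> less_of R x b \<and>
        {y\<in>elems (fcarrier R). less_of R a y \<and> less_of R y b} \<subseteq> elems V)})"

definition T1_space :: "'v space \<Rightarrow> bool" where
  "T1_space X \<longleftrightarrow> (\<forall>x\<in>elems (pts X). closed_in X (code {x}))"

definition zero_set :: "'v ofield \<Rightarrow> 'v space \<Rightarrow> 'v \<Rightarrow> bool" where
  "zero_set R X Z \<longleftrightarrow>
     (\<exists>f\<in>cmaps X (real_line R). elems Z = {x\<in>elems (pts X). app f x = fzero R})"

definition is_base :: "'v space \<Rightarrow> 'v set \<Rightarrow> bool" where
  "is_base X \<B> \<longleftrightarrow> \<B> \<subseteq> elems (opens X) \<and>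
     (\<forall>U\<in>elems (opens X). \<forall>x\<in>elems U. \<exists>B\<in>\<B>. x \<in> elems B \<and> elems B \<subseteq> elems U)"

definition Tychonoff :: "'v ofield \<Rightarrow> 'v space \<Rightarrow> bool" where
  "Tychonoff R X \<longleftrightarrow> top_space X \<and> T1_space X \<and>
     is_base X {code (elems (pts X) - elems Z) | Z. zero_set R X Z}"

end

locale ZF = set_universe mem for mem :: "'v \<Rightarrow> 'v \<Rightarrow> bool" +
  assumes extensionality: "elems a = elems b \<Longrightarrow> a = b"
    and foundation: "elems a \<noteq> {} \<Longrightarrow> \<exists>x\<in>elems a. elems x \<inter> elems a = {}"
    and pairing: "\<exists>c. elems c = {a, b}"
    and union: "\<exists>c. elems c = (\<Union>x\<in>elems a. elems x)"
    and power_set: "\<exists>c. elems c = {b. elems b \<subseteq> elems a}"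
    and infinity: "\<exists>w. (\<exists>e\<in>elems w. elems e = {}) \<and>
          (\<forall>x\<in>elems w. \<exists>y\<in>elems w. elems y = insert x (elems x))"
    and separation: "\<exists>c. elems c = {x\<in>elems a. sat mem (s(0 := x)) p}"
    and replacement: "(\<And>x. x \<in> elems a \<Longrightarrow> \<exists>!y. sat mem (s(0 := x, 1 := y)) p) \<Longrightarrow>
          \<exists>c. elems c = {y. \<exists>x\<in>elems a. sat mem (s(0 := x, 1 := y)) p}"

end

theory Submission
  imports Defs
begin

text \<open>
  Write \<open>Y\<close> for the extension, and think of \<open>X\<close> as a dense subspace of it. The proof rests on one
  transfer principle, \<open>locally_constant\<close>: if a function \<open>k\<close> from \<open>X\<close> to the reals has open fibres,
  then every point of \<open>Y\<close> has a neighbourhood whose trace on \<open>X\<close> lies in a single fibre of \<open>k\<close>.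
  Indeed \<open>k\<close> is continuous into the discrete reals, which form a closed subspace of some \<open>E\<^sup>J\<close>. Each
  coordinate of \<open>k\<close> extends to \<open>Y\<close>; closedness keeps the extended value inside the discrete reals, and
  there its singleton is open.

  The points of the real line are \<open>G\<^sub>\<delta>\<close>, so in the P-space \<open>X\<close> all fibres of a continuous real
  function are open. By the transfer principle the fibres of a continuous real function on \<open>Y\<close> are
  therefore clopen (\<open>clopen_fibre\<close>). As \<open>Y\<close> embeds in a power of the Tychonoff space \<open>E\<close>, the clopen sets
  are a base of \<open>Y\<close> (\<open>clopen_base\<close>).

  Let \<open>p\<close> lie in the open sets \<open>g 0, g 1, \<dots>\<close> of \<open>Y\<close>. For each \<open>n\<close>, \<open>CMC\<close> yields a non-empty finite set of
  clopen neighbourhoods of \<open>p\<close> inside \<open>g n\<close>; choosing one of them would take countable choice, but their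
  intersection \<open>V n\<close> is again a clopen neighbourhood (\<open>clopen_selection\<close>). Let \<open>s\<close> be an injective
  sequence of non-zero reals, and let \<open>k y\<close> be \<open>s m\<close> for the first \<open>m\<close> with \<open>y \<notin> V m\<close>, and \<open>0\<close> if there
  is none (\<open>first_exit_function\<close>). On \<open>X\<close> the fibres of \<open>k\<close> are open: the fibre of \<open>0\<close> is a \<open>G\<^sub>\<delta>\<close>, and
  that of \<open>s m\<close> is a finite intersection of clopen sets. So some neighbourhood \<open>U\<close> of \<open>p\<close> has its trace on \<open>X\<close> in
  one fibre. It is not the fibre of any \<open>s m\<close>, because \<open>U \<inter> V m\<close> is a neighbourhood of \<open>p\<close> and hence
  meets \<open>X\<close>. Thus the trace of \<open>U\<close> is contained in every \<open>V m\<close>, and so is \<open>U\<close> itself, as \<open>V m\<close> is closed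
  and \<open>X\<close> is dense (\<open>G_delta_interior\<close>).

  All of this happens in a model of ZF, where a class is a set only if an axiom says so. Most sets
  above are obtained from separation, hence they have to be defined by a first-order formula with
  parameters. The predicate \<open>definable\<close> of HOL predicates is closed under the logical connectives and
  quantifiers, so that formulas never have to be written down.
\<close>

section \<open>Formulas and definable properties\<close>

primrec rename :: "(nat \<Rightarrow> nat) \<Rightarrow> fm \<Rightarrow> fm" where
  "rename \<pi> (FMem i j) = FMem (\<pi> i) (\<pi> j)"
| "rename \<pi> (FEq i j) = FEq (\<pi> i) (\<pi> j)"
| "rename \<pi> (FNeg p) = FNeg (rename \<pi> p)"
| "rename \<pi> (FConj p q) = FConj (rename \<pi> p) (rename \<pi> q)"
| "rename \<pi> (FAll i p) = FAll (\<pi> i) (rename \<pi> p)"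

text \<open>Injectivity prevents a renamed quantifier from capturing a free variable.\<close>

lemma sat_rename:
  assumes "inj \<pi>"
  shows "sat mem s (rename \<pi> p) = sat mem (\<lambda>i. s (\<pi> i)) p"
proof (induction p arbitrary: s)
  case (FAll i p)
  have "(\<lambda>j. (s(\<pi> i := x)) (\<pi> j)) = (\<lambda>j. s (\<pi> j))(i := x)" for x
    using assms by (auto simp: fun_eq_iff inj_eq)
  then show ?case by (simp add: FAll.IH)
qed auto

text \<open>Even positions hold variables and odd positions hold parameters. Both supplies are infinite, so
  parameters of several formulas can be merged and a fresh position can always be made.\<close>

definition interleave :: "(nat \<Rightarrow> 'v) \<Rightarrow> (nat \<Rightarrow> 'v) \<Rightarrow> nat \<Rightarrow> 'v" where
  "interleave e \<sigma> i = (if even i then e (i div 2) else \<sigma> (i div 2))"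

text \<open>The language of set theory has no function symbols, so only variables and parameters can be the
  arguments of atomic formulas.\<close>

definition atomic_term :: "((nat \<Rightarrow> 'v) \<Rightarrow> 'v) \<Rightarrow> bool" where
  "atomic_term t \<longleftrightarrow> (\<exists>i. t = (\<lambda>e. e i)) \<or> (\<exists>c. t = (\<lambda>e. c))"

lemma atomic_var: "atomic_term (\<lambda>e. e i)"
  and atomic_const: "atomic_term (\<lambda>e. c)"
  by (auto simp: atomic_term_def)

lemma atomic_shift: "atomic_term t \<Longrightarrow> atomic_term (\<lambda>e. t (\<lambda>i. e (Suc i)))"
  by (auto simp: atomic_term_def)

lemma atomic_interleave:
  assumes "atomic_term t" "atomic_term u"
  shows "\<exists>\<sigma> a b. \<forall>e. interleave e \<sigma> a = t e \<and> interleave e \<sigma> b = u e"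
proof -
  have *: "\<exists>c. \<forall>k. \<exists>a. \<forall>e \<sigma>. \<sigma> k = c \<longrightarrow> interleave e \<sigma> a = w e"
    if w: "atomic_term w" for w :: "(nat \<Rightarrow> 'a) \<Rightarrow> 'a"
  proof (cases "\<exists>i. w = (\<lambda>e. e i)")
    case True
    then obtain i where "w = (\<lambda>e. e i)" by auto
    then have "\<forall>e \<sigma>. interleave e \<sigma> (2 * i) = w e" by (simp add: interleave_def)
    then show ?thesis by blast
  next
    case False
    then obtain c where "w = (\<lambda>e. c)" using w by (auto simp: atomic_term_def)
    then have "\<forall>k e \<sigma>. \<sigma> k = c \<longrightarrow> interleave e \<sigma> (2 * k + 1) = w e" by (simp add: interleave_def)
    then show ?thesis by blast
  qed
  obtain c where c: "\<forall>k. \<exists>a. \<forall>e \<sigma>. \<sigma> k = c \<longrightarrow> interleave e \<sigma> a = t e" using *[OF assms(1)] by blast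
  obtain d where d: "\<forall>k. \<exists>a. \<forall>e \<sigma>. \<sigma> k = d \<longrightarrow> interleave e \<sigma> a = u e" using *[OF assms(2)] by blast
  define \<sigma> where "\<sigma> k = (if k = (0::nat) then c else d)" for k
  obtain a where a: "\<forall>e \<sigma>. \<sigma> 0 = c \<longrightarrow> interleave e \<sigma> a = t e" using c by blast
  obtain b where b: "\<forall>e \<sigma>. \<sigma> 1 = d \<longrightarrow> interleave e \<sigma> b = u e" using d by blast
  have "\<forall>e. interleave e \<sigma> a = t e \<and> interleave e \<sigma> b = u e"
    using a b by (simp add: \<sigma>_def)
  then show ?thesis by blast
qed

context set_universe
begin

text \<open>Expressibility by a formula with parameters. The environment is read as a stack of de Bruijn indices:
  the variable of the innermost quantifier has index 0. With this convention the closure rules below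
  match HOL quantifiers by higher-order unification, and a concrete predicate is shown definable by
  applying them as introduction rules.\<close>

definition definable :: "((nat \<Rightarrow> 'v) \<Rightarrow> bool) \<Rightarrow> bool" where
  "definable P \<longleftrightarrow> (\<exists>p \<sigma>. \<forall>e. P e = sat mem (interleave e \<sigma>) p)"

lemma definable_mem:
  assumes "atomic_term t" "atomic_term u"
  shows "definable (\<lambda>e. t e \<in> elems (u e))"
proof -
  obtain \<sigma> a b where "\<forall>e. interleave e \<sigma> a = t e \<and> interleave e \<sigma> b = u e"
    using atomic_interleave[OF assms] by blast
  then have "\<forall>e. (t e \<in> elems (u e)) = sat mem (interleave e \<sigma>) (FMem a b)"
    by (simp add: elems_def)
  then show ?thesis unfolding definable_def by blast
qed

lemma definable_eq:
  assumes "atomic_term t" "atomic_term u"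
  shows "definable (\<lambda>e. t e = u e)"
proof -
  obtain \<sigma> a b where "\<forall>e. interleave e \<sigma> a = t e \<and> interleave e \<sigma> b = u e"
    using atomic_interleave[OF assms] by blast
  then have "\<forall>e. (t e = u e) = sat mem (interleave e \<sigma>) (FEq a b)"
    by simp
  then show ?thesis unfolding definable_def by blast
qed

lemma definable_not: "definable P \<Longrightarrow> definable (\<lambda>e. \<not> P e)"
  unfolding definable_def by (elim exE) (rule exI[of _ "FNeg _"], auto)

text \<open>The parameters of the two formulas are merged by interleaving them once more.\<close>

lemma definable_conj:
  assumes "definable P" "definable Q"
  shows "definable (\<lambda>e. P e \<and> Q e)"
proof -
  obtain p \<sigma> where p: "\<forall>e. P e = sat mem (interleave e \<sigma>) p"
    using assms(1) unfolding definable_def by blast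
  obtain q \<tau> where q: "\<forall>e. Q e = sat mem (interleave e \<tau>) q"
    using assms(2) unfolding definable_def by blast
  define \<pi> where "\<pi> i = (if even i then i else 2 * i - 1)" for i :: nat
  define \<rho> where "\<rho> i = (if even i then i else 2 * i + 1)" for i :: nat
  have "inj \<pi>"
    by (rule inj_on_inverseI[where g = "\<lambda>k. if even k then k else (k + 1) div 2"])
      (auto simp: \<pi>_def elim!: oddE)
  moreover have "inj \<rho>"
    by (rule inj_on_inverseI[where g = "\<lambda>k. if even k then k else k div 2"]) (simp add: \<rho>_def)
  moreover have "(\<lambda>i. interleave e (interleave \<sigma> \<tau>) (\<pi> i)) = interleave e \<sigma>" for e
  proof
    fix i
    show "interleave e (interleave \<sigma> \<tau>) (\<pi> i) = interleave e \<sigma> i"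
    proof (cases "even i")
      case False
      then obtain j where "i = 2 * j + 1" by (elim oddE)
      then have "\<pi> i = 2 * (2 * j) + 1" "i = 2 * j + 1" by (auto simp: \<pi>_def)
      then show ?thesis by (simp only:) (simp add: interleave_def)
    qed (simp add: \<pi>_def interleave_def)
  qed
  moreover have "(\<lambda>i. interleave e (interleave \<sigma> \<tau>) (\<rho> i)) = interleave e \<tau>" for e
  proof
    fix i
    show "interleave e (interleave \<sigma> \<tau>) (\<rho> i) = interleave e \<tau> i"
    proof (cases "even i")
      case False
      then obtain j where "i = 2 * j + 1" by (elim oddE)
      then have "\<rho> i = 2 * (2 * j + 1) + 1" "i = 2 * j + 1" by (auto simp: \<rho>_def)
      then show ?thesis by (simp only:) (simp add: interleave_def)
    qed (simp add: \<rho>_def interleave_def)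
  qed
  ultimately have "\<forall>e. (P e \<and> Q e) =
      sat mem (interleave e (interleave \<sigma> \<tau>)) (FConj (rename \<pi> p) (rename \<rho> q))"
    by (simp add: sat_rename p q)
  then show ?thesis unfolding definable_def by blast
qed

text \<open>Shifting the parameters frees the first odd position, which then serves as the bound variable.\<close>

lemma definable_all:
  assumes "definable (\<lambda>e. P (e 0) (\<lambda>i. e (Suc i)))"
  shows "definable (\<lambda>e. \<forall>y. P y e)"
proof -
  obtain p \<sigma> where p: "\<forall>e. P (e 0) (\<lambda>i. e (Suc i)) = sat mem (interleave e \<sigma>) p"
    using assms unfolding definable_def by blast
  define \<pi> where "\<pi> i = (if i = 0 then 1 else if even i then i - 2 else i + 2)" for i :: nat
  have inj: "inj \<pi>"
    by (rule inj_on_inverseI[where g = "\<lambda>k. if k = 1 then 0 else if even k then k + 2 else k - 2"])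
      (auto simp: \<pi>_def; presburger)
  have "(\<lambda>i. ((interleave e (case_nat c \<sigma>))(1 := y)) (\<pi> i)) = interleave (case_nat y e) \<sigma>" for e c y
  proof
    fix i
    show "((interleave e (case_nat c \<sigma>))(1 := y)) (\<pi> i) = interleave (case_nat y e) \<sigma> i"
    proof (cases "even i")
      case True
      then obtain j where j: "i = 2 * j" by (elim evenE)
      show ?thesis by (cases j) (simp_all add: j \<pi>_def interleave_def)
    next
      case False
      then obtain j where "i = 2 * j + 1" by (elim oddE)
      then have "\<pi> i = 2 * Suc j + 1" "i = 2 * j + 1" by (auto simp: \<pi>_def)
      then show ?thesis by (simp only:) (simp add: interleave_def)
    qed
  qed
  then have "sat mem (interleave e (case_nat c \<sigma>)) (FAll 1 (rename \<pi> p)) =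
      (\<forall>y. sat mem (interleave (case_nat y e) \<sigma>) p)" for e c
    by (simp add: sat_rename[OF inj])
  moreover have "sat mem (interleave (case_nat y e) \<sigma>) p = P y e" for y e
    using p[rule_format, of "case_nat y e"] by simp
  ultimately have "\<forall>e. (\<forall>y. P y e) =
      sat mem (interleave e (case_nat undefined \<sigma>)) (FAll 1 (rename \<pi> p))"
    by simp
  then show ?thesis unfolding definable_def by blast
qed

lemma definable_disj: "definable P \<Longrightarrow> definable Q \<Longrightarrow> definable (\<lambda>e. P e \<or> Q e)"
  using definable_not[OF definable_conj[OF definable_not definable_not], of P Q] by simp

lemma definable_imp: "definable P \<Longrightarrow> definable Q \<Longrightarrow> definable (\<lambda>e. P e \<longrightarrow> Q e)"
  using definable_disj[OF definable_not, of P Q] by simp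

lemma definable_iff:
  assumes "definable P" "definable Q"
  shows "definable (\<lambda>e. P e \<longleftrightarrow> Q e)"
proof -
  have "(\<lambda>e. P e \<longleftrightarrow> Q e) = (\<lambda>e. (P e \<longrightarrow> Q e) \<and> (Q e \<longrightarrow> P e))" by auto
  then show ?thesis using definable_conj definable_imp assms by simp
qed

lemma definable_ex:
  "definable (\<lambda>e. P (e 0) (\<lambda>i. e (Suc i))) \<Longrightarrow> definable (\<lambda>e. \<exists>y. P y e)"
  using definable_not[OF definable_all[of "\<lambda>y e. \<not> P y e"]] definable_not by simp

lemma definable_ball:
  assumes "atomic_term t" "definable (\<lambda>e. P (e 0) (\<lambda>i. e (Suc i)))"
  shows "definable (\<lambda>e. \<forall>y\<in>elems (t e). P y e)"
  unfolding Ball_def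
  by (intro definable_all definable_imp definable_mem atomic_var atomic_shift assms)

lemma definable_bex:
  assumes "atomic_term t" "definable (\<lambda>e. P (e 0) (\<lambda>i. e (Suc i)))"
  shows "definable (\<lambda>e. \<exists>y\<in>elems (t e). P y e)"
  unfolding Bex_def
  by (intro definable_ex definable_conj definable_mem atomic_var atomic_shift assms)

lemma definable_subset:
  assumes "atomic_term t" "atomic_term u"
  shows "definable (\<lambda>e. elems (t e) \<subseteq> elems (u e))"
  unfolding subset_eq
  by (intro definable_ball definable_mem atomic_var atomic_shift assms)

lemma definable_const: "definable (\<lambda>e. b)"
proof (cases b)
  case True
  have "definable (\<lambda>e. e 0 = e 0)" by (intro definable_eq atomic_var)
  then show ?thesis using True by simp
next
  case False
  have "definable (\<lambda>e. \<not> e 0 = e 0)" by (intro definable_not definable_eq atomic_var)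
  then show ?thesis using False by simp
qed

end

context ZF
begin

section \<open>Sets and ordered pairs of the model\<close>

definition is_set :: "'v set \<Rightarrow> bool" where
  "is_set A \<longleftrightarrow> (\<exists>a. elems a = A)"

lemma elems_inject: "elems a = elems b \<longleftrightarrow> a = b"
  using extensionality by auto

lemma code_elems [simp]: "code (elems a) = a"
  unfolding code_def by (auto simp: elems_inject)

lemma elems_code: "is_set A \<Longrightarrow> elems (code A) = A"
  unfolding is_set_def by auto

lemma is_set_elems [simp]: "is_set (elems a)"
  by (auto simp: is_set_def)

text \<open>The separation scheme, with a HOL predicate in place of the formula.\<close>

lemma is_set_Collect:
  assumes "definable (\<lambda>e. P (e 0))"
  shows "is_set {x\<in>elems a. P x}"
proof -
  obtain p \<sigma> where p: "\<And>e. P (e 0) = sat mem (interleave e \<sigma>) p"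
    using assms unfolding definable_def by blast
  have "(interleave (\<lambda>_. a) \<sigma>)(0 := x) = interleave ((\<lambda>_. a)(0 := x)) \<sigma>" for x
    by (auto simp: fun_eq_iff interleave_def elim!: evenE)
  then have "sat mem ((interleave (\<lambda>_. a) \<sigma>)(0 := x)) p = P x" for x
    using p[of "(\<lambda>_. a)(0 := x)"] by simp
  then show ?thesis
    using separation[of a "interleave (\<lambda>_. a) \<sigma>" p] by (simp add: is_set_def)
qed

lemma is_set_subset:
  assumes "definable (\<lambda>e. P (e 0))" "\<And>x. P x \<Longrightarrow> x \<in> elems a"
  shows "is_set {x. P x}"
proof -
  have "{x. P x} = {x\<in>elems a. P x}" using assms(2) by auto
  then show ?thesis using is_set_Collect[OF assms(1)] by simp
qed

lemma is_set_pair: "is_set {a, b}"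
  using pairing by (simp add: is_set_def)

lemma is_set_singleton: "is_set {a}"
  using is_set_pair[of a a] by simp

lemma is_set_empty: "is_set {}"
  using is_set_Collect[of "\<lambda>x. False" undefined] definable_const by simp

lemma elems_singleton [simp]: "elems (code {a}) = {a}"
  and elems_pair [simp]: "elems (code {a, b}) = {a, b}"
  and elems_empty [simp]: "elems (code {}) = {}"
  by (simp_all add: elems_code is_set_singleton is_set_pair is_set_empty)

lemma is_set_Un: "is_set (elems a \<union> elems b)"
proof -
  obtain c where "elems c = (\<Union>x\<in>elems (code {a, b}). elems x)" using union by blast
  then show ?thesis by (auto simp: is_set_def)
qed

lemma elems_insert [simp]: "elems (code (insert x (elems a))) = insert x (elems a)"
proof -
  have "is_set (insert x (elems a))" using is_set_Un[of "code {x}" a] by simp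
  then show ?thesis by (rule elems_code)
qed

lemma elems_pow [simp]: "elems (pow a) = {b. elems b \<subseteq> elems a}"
  unfolding pow_def by (rule elems_code) (use power_set in \<open>simp add: is_set_def\<close>)

lemma elems_Int [simp]: "elems (code (elems a \<inter> elems b)) = elems a \<inter> elems b"
proof -
  have "is_set {x\<in>elems a. x \<in> elems b}"
    by (intro is_set_Collect definable_mem atomic_var atomic_const)
  then show ?thesis by (simp add: elems_code Int_def)
qed

lemma elems_Diff [simp]: "elems (code (elems a - elems b)) = elems a - elems b"
proof -
  have "is_set {x\<in>elems a. x \<notin> elems b}"
    by (intro is_set_Collect definable_not definable_mem atomic_var atomic_const)
  then show ?thesis by (simp add: elems_code set_diff_eq)
qed

lemma elems_Union [simp]: "elems (code (\<Union>x\<in>elems a. elems x)) = (\<Union>x\<in>elems a. elems x)"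
  by (rule elems_code) (use union in \<open>simp add: is_set_def\<close>)

lemma code_pair_eq: "code {a, b} = code {c, d} \<longleftrightarrow> {a, b} = {c, d}"
  by (simp flip: elems_inject)

lemma opair_eq [simp]: "opair a b = opair c d \<longleftrightarrow> a = c \<and> b = d"
proof
  assume "opair a b = opair c d"
  then have "{code {a, a}, code {a, b}} = {code {c, c}, code {c, d}}"
    by (simp add: opair_def flip: elems_inject)
  then show "a = c \<and> b = d"
    unfolding doubleton_eq_iff[of "code _"] code_pair_eq doubleton_eq_iff by auto
qed simp

lemma eq_pair_iff: "z = code {x, y} \<longleftrightarrow> (\<forall>w. w \<in> elems z \<longleftrightarrow> w = x \<or> w = y)"
  by (subst elems_inject[symmetric]) auto

lemma eq_singleton_iff: "z = code {x} \<longleftrightarrow> (\<forall>w. w \<in> elems z \<longleftrightarrow> w = x)"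
  by (subst elems_inject[symmetric]) auto

text \<open>Reduces pairs to membership; this makes ordered pairs available in definable properties.\<close>

lemma eq_opair_iff:
  "z = opair x y \<longleftrightarrow> (\<forall>w. w \<in> elems z \<longleftrightarrow>
     (\<forall>v. v \<in> elems w \<longleftrightarrow> v = x) \<or> (\<forall>v. v \<in> elems w \<longleftrightarrow> v = x \<or> v = y))"
  unfolding opair_def eq_pair_iff eq_singleton_iff by (rule refl)

lemma definable_eq_opair:
  assumes "atomic_term t" "atomic_term u" "atomic_term w"
  shows "definable (\<lambda>e. t e = opair (u e) (w e))"
  unfolding eq_opair_iff
  by (intro definable_all definable_iff definable_disj definable_eq definable_mem
      atomic_var atomic_shift assms)

lemma definable_opair_mem:
  assumes "atomic_term t" "atomic_term u" "atomic_term w"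
  shows "definable (\<lambda>e. opair (t e) (u e) \<in> elems (w e))"
proof -
  have "definable (\<lambda>e. \<exists>z\<in>elems (w e). z = opair (t e) (u e))"
    by (intro definable_bex definable_eq_opair atomic_var atomic_shift assms)
  then show ?thesis by simp
qed

lemma definable_triple_mem:
  assumes "atomic_term t" "atomic_term u" "atomic_term v" "atomic_term w"
  shows "definable (\<lambda>e. opair (opair (t e) (u e)) (v e) \<in> elems (w e))"
proof -
  have "definable (\<lambda>e. \<exists>z. z = opair (t e) (u e) \<and> opair z (v e) \<in> elems (w e))"
    by (intro definable_ex definable_conj definable_eq_opair definable_opair_mem
        atomic_var atomic_shift assms)
  then show ?thesis by simp
qed

lemmas definable_intros =
  definable_all definable_ex definable_ball definable_bex definable_conj definable_disj
  definable_imp definable_iff definable_not definable_subset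
  definable_triple_mem definable_opair_mem definable_eq_opair definable_mem definable_eq
  definable_const
  atomic_var atomic_const

section \<open>Functions of the model\<close>

lemma elems_cprod [simp]: "elems (cprod a b) = {opair x y | x y. x \<in> elems a \<and> y \<in> elems b}"
proof -
  obtain c where c: "elems c = elems a \<union> elems b" using is_set_Un[of a b] by (auto simp: is_set_def)
  have "definable (\<lambda>e. \<exists>x y. e 0 = opair x y \<and> x \<in> elems a \<and> y \<in> elems b)"
    by (intro definable_intros)
  moreover have "z \<in> elems (pow (pow c))" if z: "\<exists>x y. z = opair x y \<and> x \<in> elems a \<and> y \<in> elems b" for z
  proof -
    obtain x y where "z = opair x y" "x \<in> elems c" "y \<in> elems c" using z c by blast
    then show ?thesis by (simp add: opair_def)
  qed
  ultimately have "is_set {z. \<exists>x y. z = opair x y \<and> x \<in> elems a \<and> y \<in> elems b}"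
    by (rule is_set_subset)
  then show ?thesis unfolding cprod_def by (rule elems_code)
qed

lemma opair_mem_cprod [simp]: "opair x y \<in> elems (cprod a b) \<longleftrightarrow> x \<in> elems a \<and> y \<in> elems b"
  by simp

lemma opair_mem_fun:
  assumes "f \<in> funs a b"
  shows "opair x y \<in> elems f \<longleftrightarrow> x \<in> elems a \<and> y = app f x"
proof -
  have sub: "elems f \<subseteq> elems (cprod a b)" and uniq: "x \<in> elems a \<Longrightarrow> \<exists>!y. opair x y \<in> elems f"
    using assms by (auto simp: funs_def)
  have dom: "x \<in> elems a" if "opair x y \<in> elems f" for y
    using that sub opair_mem_cprod by blast
  show ?thesis
  proof (cases "x \<in> elems a")
    case True
    then have "opair x (app f x) \<in> elems f"
      unfolding app_def using theI'[OF uniq] by blast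
    then show ?thesis using uniq True by auto
  qed (use dom in blast)
qed

lemma app_in:
  assumes "f \<in> funs a b" "x \<in> elems a"
  shows "app f x \<in> elems b"
proof -
  have "opair x (app f x) \<in> elems f" using assms by (simp add: opair_mem_fun)
  then have "opair x (app f x) \<in> elems (cprod a b)" using assms(1) unfolding funs_def by blast
  then show ?thesis by simp
qed

lemma funs_mono: "f \<in> funs a b \<Longrightarrow> elems b \<subseteq> elems c \<Longrightarrow> f \<in> funs a c"
  unfolding funs_def by (simp add: subset_eq) blast

text \<open>The source of almost all functions of the model below: values that are determined by a definable
  relation can be collected without choice.\<close>

lemma function_exists:
  assumes "definable (\<lambda>e. \<phi> (e 0) (e 1))"
    and "\<And>x. x \<in> elems a \<Longrightarrow> \<exists>y. y \<in> elems b \<and> \<phi> x y"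
    and "\<And>x y z. x \<in> elems a \<Longrightarrow> y \<in> elems b \<Longrightarrow> z \<in> elems b \<Longrightarrow> \<phi> x y \<Longrightarrow> \<phi> x z \<Longrightarrow> y = z"
  obtains f where "f \<in> funs a b" "\<And>x. x \<in> elems a \<Longrightarrow> \<phi> x (app f x)"
proof -
  have "definable (\<lambda>e. \<exists>y x. e 0 = opair x y \<and> \<phi> x y)"
    by (intro definable_intros) (use assms(1) in simp)
  then have "is_set {z\<in>elems (cprod a b). \<exists>y x. z = opair x y \<and> \<phi> x y}"
    by (rule is_set_Collect)
  then obtain f where f: "elems f = {z\<in>elems (cprod a b). \<exists>y x. z = opair x y \<and> \<phi> x y}"
    by (auto simp: is_set_def)
  then have mem: "opair x y \<in> elems f \<longleftrightarrow> x \<in> elems a \<and> y \<in> elems b \<and> \<phi> x y" for x y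
    by auto
  have "f \<in> funs a b"
    unfolding funs_def using assms(2,3) mem f by blast
  moreover from this have "\<phi> x (app f x)" if "x \<in> elems a" for x
    using mem[of x "app f x"] that by (simp add: opair_mem_fun)
  ultimately show thesis using that by blast
qed

lemma composition_exists:
  assumes "f \<in> funs a b" "g \<in> funs b c"
  obtains k where "k \<in> funs a c" "\<And>x. x \<in> elems a \<Longrightarrow> app k x = app g (app f x)"
proof (rule function_exists[of "\<lambda>x z. \<exists>y. opair x y \<in> elems f \<and> opair y z \<in> elems g" a c])
  show "definable (\<lambda>e. \<exists>y. opair (e 0) y \<in> elems f \<and> opair y (e 1) \<in> elems g)"
    by (intro definable_intros)
qed (use that in \<open>auto simp: opair_mem_fun[OF assms(1)] opair_mem_fun[OF assms(2)] app_in[OF assms(1)] app_in[OF assms(2)]\<close>)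

lemma elems_image_set:
  assumes "f \<in> funs a b"
  shows "elems (image_set f a) = app f ` elems a"
proof -
  have "definable (\<lambda>e. \<exists>x\<in>elems a. opair x (e 0) \<in> elems f)" by (intro definable_intros)
  then have "is_set {y\<in>elems b. \<exists>x\<in>elems a. opair x y \<in> elems f}" by (rule is_set_Collect)
  moreover have "{y\<in>elems b. \<exists>x\<in>elems a. opair x y \<in> elems f} = app f ` elems a"
    using assms by (auto simp: opair_mem_fun app_in)
  ultimately show ?thesis unfolding image_set_def by (simp add: elems_code)
qed

section \<open>Natural numbers and recursion\<close>

definition succ :: "'v \<Rightarrow> 'v" where
  "succ x = code (insert x (elems x))"

abbreviation zero :: 'v where
  "zero \<equiv> code {}"

lemma elems_succ [simp]: "elems (succ x) = insert x (elems x)"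
  by (simp add: succ_def)

lemma definable_eq_succ:
  assumes "atomic_term t" "atomic_term u"
  shows "definable (\<lambda>e. t e = succ (u e))"
proof -
  have "(\<lambda>e. t e = succ (u e)) = (\<lambda>e. \<forall>w. w \<in> elems (t e) \<longleftrightarrow> w = u e \<or> w \<in> elems (u e))"
    by (auto simp: fun_eq_iff simp flip: elems_inject)
  moreover have "definable \<dots>"
    by (intro definable_intros atomic_shift assms)
  ultimately show ?thesis by simp
qed

lemma inductive_exists: "\<exists>w. is_inductive w"
proof -
  obtain w where w: "\<exists>e\<in>elems w. elems e = {}"
    "\<forall>x\<in>elems w. \<exists>y\<in>elems w. elems y = insert x (elems x)" using infinity by blast
  have "is_inductive w"
    unfolding is_inductive_def
  proof (intro conjI ballI)
    show "code {} \<in> elems w" using w(1) by (metis code_elems)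
    show "code (insert x (elems x)) \<in> elems w" if "x \<in> elems w" for x
      using w(2) that by (metis code_elems)
  qed
  then show ?thesis by blast
qed

lemma elems_omega: "elems omega = {n. \<forall>w. is_inductive w \<longrightarrow> n \<in> elems w}"
proof -
  have ind: "is_inductive w \<longleftrightarrow> zero \<in> elems w \<and> (\<forall>x\<in>elems w. \<exists>y\<in>elems w. y = succ x)" for w
    unfolding is_inductive_def succ_def[symmetric] by auto
  have "definable (\<lambda>e. \<forall>w. is_inductive w \<longrightarrow> e 0 \<in> elems w)"
    unfolding ind by (intro definable_intros definable_eq_succ)
  moreover obtain w where "is_inductive w" using inductive_exists by blast
  ultimately have "is_set {n. \<forall>w. is_inductive w \<longrightarrow> n \<in> elems w}"
    using is_set_subset[of "\<lambda>n. \<forall>w. is_inductive w \<longrightarrow> n \<in> elems w" w] by blast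
  then show ?thesis unfolding omega_def by (rule elems_code)
qed

lemma zero_in_omega [simp]: "zero \<in> elems omega"
  and succ_in_omega [simp]: "n \<in> elems omega \<Longrightarrow> succ n \<in> elems omega"
  unfolding elems_omega is_inductive_def succ_def by auto

text \<open>The \<open>\<omega>\<close> of the model may contain nonstandard numbers, so induction is available for definable
  properties only.\<close>

lemma omega_induct [consumes 1, case_names definable zero succ]:
  assumes "n \<in> elems omega" "definable (\<lambda>e. P (e 0))"
    and "P zero" "\<And>n. n \<in> elems omega \<Longrightarrow> P n \<Longrightarrow> P (succ n)"
  shows "P n"
proof -
  obtain w where w: "elems w = {n\<in>elems omega. P n}"
    using is_set_Collect[OF assms(2)] by (auto simp: is_set_def)
  have "is_inductive w"
    unfolding is_inductive_def succ_def[symmetric] w using assms(3,4) by auto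
  then have "n \<in> elems w" using assms(1) by (auto simp: elems_omega)
  then show ?thesis by (simp add: w)
qed

lemma mem_asym: "x \<in> elems y \<Longrightarrow> y \<notin> elems x"
  using foundation[of "code {x, y}"] by auto

lemma succ_inject: "succ m = succ n \<longleftrightarrow> m = n"
proof
  assume "succ m = succ n"
  then have "insert m (elems m) = insert n (elems n)" by (metis elems_succ)
  then have "m \<in> insert n (elems n)" "n \<in> insert m (elems m)" by auto
  then show "m = n" using mem_asym[of m n] by auto
qed simp

lemma succ_neq_zero: "succ n \<noteq> zero"
  by (simp flip: elems_inject)

lemma omega_subset: "n \<in> elems omega \<Longrightarrow> elems n \<subseteq> elems omega"
proof (induction n rule: omega_induct)
  case definable
  show ?case by (intro definable_intros)
qed auto

lemma omega_zero_mem: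
  assumes "n \<in> elems omega"
  shows "n = zero \<or> zero \<in> elems n"
  using assms
proof (induction n rule: omega_induct)
  case definable
  show ?case by (intro definable_intros)
qed auto

lemma omega_succ_mem:
  assumes "n \<in> elems omega" "m \<in> elems n"
  shows "succ m = n \<or> succ m \<in> elems n"
proof -
  have "\<forall>m\<in>elems n. \<exists>k. k = succ m \<and> (k = n \<or> k \<in> elems n)"
    using assms(1)
  proof (induction n rule: omega_induct)
    case definable
    show ?case by (intro definable_intros definable_eq_succ)
  qed auto
  then show ?thesis using assms(2) by auto
qed

lemma omega_trichotomy:
  assumes "m \<in> elems omega" "n \<in> elems omega"
  shows "m = n \<or> m \<in> elems n \<or> n \<in> elems m"
proof -
  have "\<forall>n\<in>elems omega. m = n \<or> m \<in> elems n \<or> n \<in> elems m"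
    using assms(1)
  proof (induction m rule: omega_induct)
    case definable
    show ?case by (intro definable_intros)
  next
    case zero
    then show ?case using omega_zero_mem by blast
  next
    case (succ m)
    show ?case
    proof
      fix n assume "n \<in> elems omega"
      then have "m = n \<or> m \<in> elems n \<or> n \<in> elems m" and "m \<in> elems n \<Longrightarrow> succ m = n \<or> succ m \<in> elems n"
        using succ omega_succ_mem by auto
      then show "succ m = n \<or> succ m \<in> elems n \<or> n \<in> elems (succ m)" by auto
    qed
  qed
  then show ?thesis using assms(2) by blast
qed

text \<open>An \<open>\<in>\<close>-minimal number with the property, by foundation.\<close>

lemma omega_least:
  assumes "definable (\<lambda>e. P (e 0))" "n \<in> elems omega" "P n"
  obtains m where "m \<in> elems omega" "P m" "\<And>i. i \<in> elems m \<Longrightarrow> \<not> P i"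
proof -
  obtain w where w: "elems w = {n\<in>elems omega. P n}"
    using is_set_Collect[OF assms(1)] by (auto simp: is_set_def)
  then have "elems w \<noteq> {}" using assms(2,3) by auto
  then obtain m where m: "m \<in> elems w" "elems m \<inter> elems w = {}" using foundation by blast
  then show thesis using that[of m] w omega_subset[of m] by auto
qed

lemma least_missing_index:
  assumes V: "V \<in> funs omega D"
  shows "(\<forall>i\<in>elems omega. y \<in> elems (app V i)) \<or>
    (\<exists>m\<in>elems omega. y \<notin> elems (app V m) \<and> (\<forall>i\<in>elems m. y \<in> elems (app V i)))"
proof (cases "\<forall>i\<in>elems omega. y \<in> elems (app V i)")
  case False
  let ?P = "\<lambda>n. \<exists>U. opair n U \<in> elems V \<and> y \<notin> elems U"
  have P: "?P n \<longleftrightarrow> y \<notin> elems (app V n)" if "n \<in> elems omega" for n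
    using that by (auto simp: opair_mem_fun[OF V])
  have def: "definable (\<lambda>e. ?P (e 0))" by (intro definable_intros)
  obtain n where n: "n \<in> elems omega" "?P n" using False P by blast
  obtain m where m: "m \<in> elems omega" "?P m" "\<And>i. i \<in> elems m \<Longrightarrow> \<not> ?P i"
    using omega_least[of ?P, OF def n] by blast
  have "y \<in> elems (app V i)" if "i \<in> elems m" for i
    using m(3)[OF that] P[of i] omega_subset[OF m(1)] that by blast
  then show ?thesis using m(1,2) P[OF m(1)] by blast
qed blast

text \<open>The least set of pairs that contains the initial pair and is closed under the recursion step. It is a
  function because a pair that the recursion does not demand could be removed from it.\<close>

lemma recursion_exists:
  assumes "a \<in> elems C" "F \<in> funs C C"
  obtains s where "s \<in> funs omega C" "app s zero = a"
    "\<And>n. n \<in> elems omega \<Longrightarrow> app s (succ n) = app F (app s n)"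
proof -
  define closed where "closed S \<longleftrightarrow> opair zero a \<in> elems S \<and> (\<forall>n\<in>elems omega. \<forall>x\<in>elems C. opair n x \<in> elems S \<longrightarrow>
      (\<forall>m. m = succ n \<longrightarrow> (\<forall>y. opair x y \<in> elems F \<longrightarrow> opair m y \<in> elems S)))" for S
  have closedI: "closed S" if "opair zero a \<in> elems S"
    "\<And>n x. n \<in> elems omega \<Longrightarrow> x \<in> elems C \<Longrightarrow> opair n x \<in> elems S \<Longrightarrow> opair (succ n) (app F x) \<in> elems S" for S
    using that by (auto simp: closed_def opair_mem_fun[OF assms(2)])
  have closedD: "opair (succ n) (app F x) \<in> elems S"
    if "closed S" "n \<in> elems omega" "x \<in> elems C" "opair n x \<in> elems S" for S n x
    using that unfolding closed_def by (simp add: opair_mem_fun[OF assms(2)])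
  have "definable (\<lambda>e. \<forall>S. closed S \<longrightarrow> e 0 \<in> elems S)"
    unfolding closed_def by (intro definable_intros definable_eq_succ)
  then have "is_set {z\<in>elems (cprod omega C). \<forall>S. closed S \<longrightarrow> z \<in> elems S}"
    by (rule is_set_Collect)
  then obtain T where T: "elems T = {z\<in>elems (cprod omega C). \<forall>S. closed S \<longrightarrow> z \<in> elems S}"
    by (auto simp: is_set_def)
  have "closed T"
  proof (rule closedI)
    show "opair zero a \<in> elems T" using assms(1) by (auto simp: T closed_def)
    show "opair (succ n) (app F x) \<in> elems T"
      if "n \<in> elems omega" "x \<in> elems C" "opair n x \<in> elems T" for n x
      using that closedD app_in[OF assms(2)] by (auto simp: T)
  qed
  (* removing a pair that the recursion does not demand keeps a set closed *)
  have forced: "(n = zero \<and> x = a) \<or> (\<exists>m y. m \<in> elems omega \<and> y \<in> elems C \<and> opair m y \<in> elems T \<and> n = succ m \<and> x = app F y)"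
    if "opair n x \<in> elems T" for n x
  proof (rule ccontr)
    assume neg: "\<not> ?thesis"
    define S where "S = code (elems T - elems (code {opair n x}))"
    have S: "elems S = elems T - {opair n x}"
      unfolding S_def by (subst elems_Diff) simp
    have "closed S"
    proof (rule closedI)
      show "opair zero a \<in> elems S" using neg \<open>closed T\<close> by (auto simp: S closed_def)
      show "opair (succ m) (app F y) \<in> elems S"
        if "m \<in> elems omega" "y \<in> elems C" "opair m y \<in> elems S" for m y
        using that neg closedD[OF \<open>closed T\<close>, of m y] by (auto simp: S)
    qed
    then have "opair n x \<in> elems S" using that by (simp add: T)
    then show False by (simp add: S)
  qed
  have ex1: "\<exists>x. opair n x \<in> elems T \<and> (\<forall>y. opair n y \<in> elems T \<longrightarrow> y = x)" if "n \<in> elems omega" for n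
    using that
  proof (induction n rule: omega_induct)
    case definable
    show ?case by (intro definable_intros)
  next
    case zero
    show ?case using \<open>closed T\<close> forced succ_neq_zero by (metis closed_def)
  next
    case (succ n)
    then obtain x where x: "opair n x \<in> elems T" "\<And>y. opair n y \<in> elems T \<Longrightarrow> y = x" by blast
    then have "x \<in> elems C" by (auto simp: T)
    then have "opair (succ n) (app F x) \<in> elems T" using closedD \<open>closed T\<close> x succ by blast
    moreover have "y = app F x" if y: "opair (succ n) y \<in> elems T" for y
    proof -
      obtain m z where "opair m z \<in> elems T" "succ n = succ m" "y = app F z"
        using forced[OF y] succ_neq_zero by blast
      then show ?thesis using x(2)[of z] by (simp add: succ_inject)
    qed
    ultimately show ?case by blast
  qed
  have s: "T \<in> funs omega C"
    unfolding funs_def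
  proof (intro CollectI conjI ballI)
    show "elems T \<subseteq> elems (cprod omega C)" by (auto simp: T)
    show "\<exists>!y. opair n y \<in> elems T" if "n \<in> elems omega" for n
      using ex1[OF that] by (elim exE conjE) (rule ex1I, assumption, blast)
  qed
  show thesis
  proof (rule that[OF s])
    show "app T zero = a" using \<open>closed T\<close> opair_mem_fun[OF s] by (auto simp: closed_def)
    show "app T (succ n) = app F (app T n)" if "n \<in> elems omega" for n
    proof -
      have "opair n (app T n) \<in> elems T" using opair_mem_fun[OF s] that by blast
      then have "opair (succ n) (app F (app T n)) \<in> elems T"
        by (rule closedD[OF \<open>closed T\<close> that app_in[OF s that]])
      then show ?thesis unfolding opair_mem_fun[OF s] by simp
    qed
  qed
qed

section \<open>Topological spaces of the model\<close>

definition is_open :: "'v space \<Rightarrow> 'v set \<Rightarrow> bool" where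
  "is_open X A \<longleftrightarrow> (\<exists>U\<in>elems (opens X). elems U = A)"

lemma is_open_elems: "is_open X (elems U) \<longleftrightarrow> U \<in> elems (opens X)"
  by (auto simp: is_open_def elems_inject)

lemma is_open_is_set: "is_open X A \<Longrightarrow> is_set A"
  by (auto simp: is_open_def)

lemma code_in_opens: "is_set A \<Longrightarrow> code A \<in> elems (opens X) \<longleftrightarrow> is_open X A"
  by (metis elems_code is_open_elems)

lemma mem_iff_Bex: "(\<And>w. w = c \<longleftrightarrow> P w) \<Longrightarrow> c \<in> A \<longleftrightarrow> (\<exists>w\<in>A. P w)"
proof -
  assume "\<And>w. w = c \<longleftrightarrow> P w"
  then have "P = (\<lambda>w. w = c)" by auto
  then show ?thesis by simp
qed

text \<open>A form without set formation, from which definability can be read off.\<close>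

lemma top_space_iff:
  "top_space (Space P T) \<longleftrightarrow>
     (\<forall>U\<in>elems T. elems U \<subseteq> elems P) \<and> zero \<in> elems T \<and> P \<in> elems T \<and>
     (\<forall>U\<in>elems T. \<forall>V\<in>elems T. \<exists>W\<in>elems T. \<forall>x. x \<in> elems W \<longleftrightarrow> x \<in> elems U \<and> x \<in> elems V) \<and>
     (\<forall>S. elems S \<subseteq> elems T \<longrightarrow> (\<exists>W\<in>elems T. \<forall>x. x \<in> elems W \<longleftrightarrow> (\<exists>U\<in>elems S. x \<in> elems U)))"
proof -
  have 1: "code (elems U \<inter> elems V) \<in> elems T \<longleftrightarrow>
      (\<exists>W\<in>elems T. \<forall>x. x \<in> elems W \<longleftrightarrow> x \<in> elems U \<and> x \<in> elems V)" for U V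
  proof -
    have "W = code (elems U \<inter> elems V) \<longleftrightarrow> (\<forall>x. x \<in> elems W \<longleftrightarrow> x \<in> elems U \<and> x \<in> elems V)" for W
      by (subst elems_inject[symmetric]) auto
    then show ?thesis by (rule mem_iff_Bex)
  qed
  have 2: "code (\<Union>U\<in>elems S. elems U) \<in> elems T \<longleftrightarrow>
      (\<exists>W\<in>elems T. \<forall>x. x \<in> elems W \<longleftrightarrow> (\<exists>U\<in>elems S. x \<in> elems U))" for S
  proof -
    have "W = code (\<Union>U\<in>elems S. elems U) \<longleftrightarrow> (\<forall>x. x \<in> elems W \<longleftrightarrow> (\<exists>U\<in>elems S. x \<in> elems U))" for W
      by (subst elems_inject[symmetric]) auto
    then show ?thesis by (rule mem_iff_Bex)
  qed
  show ?thesis unfolding top_space_def space.sel 1 2 by (rule refl)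
qed

lemma is_open_subset: "top_space X \<Longrightarrow> is_open X A \<Longrightarrow> A \<subseteq> elems (pts X)"
  by (auto simp: is_open_def top_space_def)

lemma is_open_pts: "top_space X \<Longrightarrow> is_open X (elems (pts X))"
  by (auto simp: is_open_elems top_space_def)

lemma is_open_empty: "top_space X \<Longrightarrow> is_open X {}"
  unfolding is_open_def top_space_def using elems_empty by blast

lemma is_open_Int: "top_space X \<Longrightarrow> is_open X A \<Longrightarrow> is_open X B \<Longrightarrow> is_open X (A \<inter> B)"
  unfolding is_open_def top_space_def using elems_Int by blast

text \<open>No neighbourhoods are chosen here: \<open>A\<close> is the union of all its open subsets.\<close>

lemma is_openI:
  assumes "top_space X" "is_set A"
    and "\<And>x. x \<in> A \<Longrightarrow> \<exists>U. is_open X U \<and> x \<in> U \<and> U \<subseteq> A"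
  shows "is_open X A"
proof -
  obtain a where a: "elems a = A" using assms(2) by (auto simp: is_set_def)
  have "definable (\<lambda>e. elems (e 0) \<subseteq> elems a)" by (intro definable_intros)
  then have "is_set {U\<in>elems (opens X). elems U \<subseteq> elems a}" by (rule is_set_Collect)
  then obtain S where S: "elems S = {U\<in>elems (opens X). elems U \<subseteq> elems a}" by (auto simp: is_set_def)
  then have "elems S \<subseteq> elems (opens X)" by blast
  then have "code (\<Union>U\<in>elems S. elems U) \<in> elems (opens X)"
    using assms(1) unfolding top_space_def by blast
  moreover have "(\<Union>U\<in>elems S. elems U) = A"
    using assms(3) by (auto simp: S a is_open_def)
  ultimately show ?thesis unfolding is_open_def using elems_Union by metis
qed

lemma is_set_vimage:
  assumes "f \<in> funs a b" "is_set V"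
  shows "is_set {x\<in>elems a. app f x \<in> V}"
proof -
  obtain v where v: "elems v = V" using assms(2) by (auto simp: is_set_def)
  have "definable (\<lambda>e. \<exists>y\<in>elems v. opair (e 0) y \<in> elems f)" by (intro definable_intros)
  then have "is_set {x\<in>elems a. \<exists>y\<in>elems v. opair x y \<in> elems f}" by (rule is_set_Collect)
  moreover have "{x\<in>elems a. \<exists>y\<in>elems v. opair x y \<in> elems f} = {x\<in>elems a. app f x \<in> V}"
    using v by (auto simp: opair_mem_fun[OF assms(1)])
  ultimately show ?thesis by simp
qed

lemma cmaps_iff:
  "f \<in> cmaps X Y \<longleftrightarrow> f \<in> funs (pts X) (pts Y) \<and>
     (\<forall>V. is_open Y V \<longrightarrow> is_open X {x\<in>elems (pts X). app f x \<in> V})"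
proof -
  have "code {x\<in>elems (pts X). app f x \<in> elems V} \<in> elems (opens X) \<longleftrightarrow>
      is_open X {x\<in>elems (pts X). app f x \<in> elems V}" if "f \<in> funs (pts X) (pts Y)" for V
    using that by (intro code_in_opens is_set_vimage) auto
  moreover have "(\<forall>V. is_open Y V \<longrightarrow> Q V) \<longleftrightarrow> (\<forall>V\<in>elems (opens Y). Q (elems V))" for Q
    by (auto simp: is_open_def)
  ultimately show ?thesis
    unfolding cmaps_def by auto
qed

lemma cmaps_funs: "f \<in> cmaps X Y \<Longrightarrow> f \<in> funs (pts X) (pts Y)"
  by (simp add: cmaps_iff)

lemma cmaps_app: "f \<in> cmaps X Y \<Longrightarrow> x \<in> elems (pts X) \<Longrightarrow> app f x \<in> elems (pts Y)"
  using app_in cmaps_funs by blast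

lemma cmaps_vimage:
  "f \<in> cmaps X Y \<Longrightarrow> is_open Y V \<Longrightarrow> is_open X {x\<in>elems (pts X). app f x \<in> V}"
  by (simp add: cmaps_iff)

lemma closed_in_iff:
  "closed_in X s \<longleftrightarrow> elems s \<subseteq> elems (pts X) \<and> is_open X (elems (pts X) - elems s)"
  unfolding closed_in_def by (metis code_in_opens elems_Diff is_set_elems)

lemma is_open_subspace:
  "is_open (subspace X s) A \<longleftrightarrow> (\<exists>U. is_open X U \<and> A = U \<inter> elems s)"
proof -
  have "definable (\<lambda>e. \<exists>U\<in>elems (opens X). \<forall>x. x \<in> elems (e 0) \<longleftrightarrow> x \<in> elems U \<and> x \<in> elems s)"
    by (intro definable_intros)
  then have "is_set {V\<in>elems (pow s). \<exists>U\<in>elems (opens X). \<forall>x. x \<in> elems V \<longleftrightarrow> x \<in> elems U \<and> x \<in> elems s}"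
    by (rule is_set_Collect)
  moreover have "{V\<in>elems (pow s). \<exists>U\<in>elems (opens X). \<forall>x. x \<in> elems V \<longleftrightarrow> x \<in> elems U \<and> x \<in> elems s} =
      (\<lambda>U. code (elems U \<inter> elems s)) ` elems (opens X)" (is "?L = ?R")
  proof -
    have "V = code (elems U \<inter> elems s) \<longleftrightarrow> (\<forall>x. x \<in> elems V \<longleftrightarrow> x \<in> elems U \<and> x \<in> elems s)" for U V
      by (subst elems_inject[symmetric]) auto
    then have "?R = {V. \<exists>U\<in>elems (opens X). \<forall>x. x \<in> elems V \<longleftrightarrow> x \<in> elems U \<and> x \<in> elems s}"
      by (auto simp: image_def)
    then show ?thesis by auto
  qed
  ultimately have "elems (opens (subspace X s)) = (\<lambda>U. code (elems U \<inter> elems s)) ` elems (opens X)"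
    by (simp add: subspace_def elems_code)
  then show ?thesis by (auto simp: is_open_def)
qed

lemma pts_subspace [simp]: "pts (subspace X s) = s"
  by (simp add: subspace_def)

lemma is_open_discrete: "is_open (discrete a) A \<longleftrightarrow> is_set A \<and> A \<subseteq> elems a"
  by (auto simp: is_open_def discrete_def is_set_def)

lemma pts_discrete [simp]: "pts (discrete a) = a"
  by (simp add: discrete_def)

section \<open>Powers of a space\<close>

lemma elems_funs [simp]: "elems (code (funs a b)) = funs a b"
proof -
  have "definable (\<lambda>e. elems (e 0) \<subseteq> elems (cprod a b) \<and>
      (\<forall>x\<in>elems a. \<exists>y. opair x y \<in> elems (e 0) \<and> (\<forall>z. opair x z \<in> elems (e 0) \<longrightarrow> z = y)))"
    by (intro definable_intros)
  then have "is_set {f. elems f \<subseteq> elems (cprod a b) \<and>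
      (\<forall>x\<in>elems a. \<exists>y. opair x y \<in> elems f \<and> (\<forall>z. opair x z \<in> elems f \<longrightarrow> z = y))}"
    by (rule is_set_subset[of _ "pow (cprod a b)"]) (simp only: elems_pow mem_Collect_eq)
  then have "is_set (funs a b)" unfolding funs_def Ex1_def .
  then show ?thesis by (rule elems_code)
qed

lemma pts_power_space [simp]: "elems (pts (power_space E J)) = funs J (pts E)"
  by (simp add: power_space_def Let_def)

text \<open>The class of all sets that belong to every admissible topology is a set of the model, since it is
  definable and the discrete topology is admissible.\<close>

lemma elems_opens_power_space:
  "elems (opens (power_space E J)) = {W. \<forall>T. top_space (Space (code (funs J (pts E))) T) \<and>
     (\<forall>j\<in>elems J. \<forall>U\<in>elems (opens E). code {f\<in>funs J (pts E). app f j \<in> elems U} \<in> elems T) \<longrightarrow> W \<in> elems T}"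
proof -
  let ?P = "code (funs J (pts E))"
  have sub: "is_set {f\<in>funs J (pts E). app f j \<in> elems U}
      \<and> (\<forall>f. f \<in> {f\<in>funs J (pts E). app f j \<in> elems U} \<longleftrightarrow> f \<in> elems ?P \<and> (\<exists>u\<in>elems U. opair j u \<in> elems f))"
    if "j \<in> elems J" for j U
  proof -
    have "definable (\<lambda>e. \<exists>u\<in>elems U. opair j u \<in> elems (e 0))" by (intro definable_intros)
    then have "is_set {f\<in>elems ?P. \<exists>u\<in>elems U. opair j u \<in> elems f}" by (rule is_set_Collect)
    moreover have "{f\<in>elems ?P. \<exists>u\<in>elems U. opair j u \<in> elems f} = {f\<in>funs J (pts E). app f j \<in> elems U}"
      using that by (auto simp: opair_mem_fun)
    ultimately show ?thesis by auto
  qed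
  have sub_iff: "code {f\<in>funs J (pts E). app f j \<in> elems U} \<in> elems T \<longleftrightarrow>
      (\<exists>B\<in>elems T. \<forall>f. f \<in> elems B \<longleftrightarrow> f \<in> elems ?P \<and> (\<exists>u\<in>elems U. opair j u \<in> elems f))"
    if "j \<in> elems J" for j U T
  proof -
    have "B = code {f\<in>funs J (pts E). app f j \<in> elems U} \<longleftrightarrow>
        (\<forall>f. f \<in> elems B \<longleftrightarrow> f \<in> elems ?P \<and> (\<exists>u\<in>elems U. opair j u \<in> elems f))" for B
    proof -
      have m: "f \<in> elems (code {f\<in>funs J (pts E). app f j \<in> elems U}) \<longleftrightarrow>
          f \<in> elems ?P \<and> (\<exists>u\<in>elems U. opair j u \<in> elems f)" for f
        using sub[OF that, of U] elems_code by blast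
      show ?thesis by (subst elems_inject[symmetric], subst set_eq_iff, subst m, rule refl)
    qed
    then show ?thesis by (rule mem_iff_Bex)
  qed
  let ?Q = "\<lambda>W. \<forall>T. top_space (Space ?P T) \<and>
     (\<forall>j\<in>elems J. \<forall>U\<in>elems (opens E).
        \<exists>B\<in>elems T. \<forall>f. f \<in> elems B \<longleftrightarrow> f \<in> elems ?P \<and> (\<exists>u\<in>elems U. opair j u \<in> elems f)) \<longrightarrow> W \<in> elems T"
  have "definable (\<lambda>e. ?Q (e 0))"
    unfolding top_space_iff by (intro definable_intros)
  moreover have "W \<in> elems (pow ?P)" if "?Q W" for W
  proof -
    have "top_space (Space ?P (pow ?P))"
      unfolding top_space_def by auto
    moreover have "\<forall>j\<in>elems J. \<forall>U\<in>elems (opens E). \<exists>B\<in>elems (pow ?P).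
        \<forall>f. f \<in> elems B \<longleftrightarrow> f \<in> elems ?P \<and> (\<exists>u\<in>elems U. opair j u \<in> elems f)"
    proof (intro ballI)
      fix j U assume j: "j \<in> elems J"
      obtain B where B: "elems B = {f\<in>funs J (pts E). app f j \<in> elems U}"
        using sub[OF j] unfolding is_set_def by blast
      show "\<exists>B\<in>elems (pow ?P). \<forall>f. f \<in> elems B \<longleftrightarrow> f \<in> elems ?P \<and> (\<exists>u\<in>elems U. opair j u \<in> elems f)"
        using sub[OF j, of U] B by (intro bexI[of _ B]) (simp, auto)
    qed
    ultimately show ?thesis using that by blast
  qed
  ultimately have "is_set {W. ?Q W}" by (rule is_set_subset)
  moreover have "{W. \<forall>T. top_space (Space ?P T) \<and>
     (\<forall>j\<in>elems J. \<forall>U\<in>elems (opens E). code {f\<in>funs J (pts E). app f j \<in> elems U} \<in> elems T) \<longrightarrow> W \<in> elems T} = {W. ?Q W}"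
    by (simp add: sub_iff)
  ultimately show ?thesis
    unfolding power_space_def Let_def space.sel by (simp add: elems_code)
qed

lemma is_set_projection_vimage:
  assumes "is_set U" "j \<in> elems J"
  shows "is_set {f\<in>funs J b. app f j \<in> U}"
proof -
  obtain u where u: "elems u = U" using assms(1) by (auto simp: is_set_def)
  have "definable (\<lambda>e. \<exists>y\<in>elems u. opair j y \<in> elems (e 0))" by (intro definable_intros)
  then have "is_set {f\<in>elems (code (funs J b)). \<exists>y\<in>elems u. opair j y \<in> elems f}" by (rule is_set_Collect)
  moreover have "{f\<in>elems (code (funs J b)). \<exists>y\<in>elems u. opair j y \<in> elems f} = {f\<in>funs J b. app f j \<in> U}"
    using assms(2) u by (auto simp: opair_mem_fun)
  ultimately show ?thesis by simp
qed

lemma is_open_projection: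
  assumes "is_open E U" "j \<in> elems J"
  shows "is_open (power_space E J) {f\<in>funs J (pts E). app f j \<in> U}"
proof -
  obtain u where u: "u \<in> elems (opens E)" "elems u = U" using assms(1) by (auto simp: is_open_def)
  have "code {f\<in>funs J (pts E). app f j \<in> elems u} \<in> elems (opens (power_space E J))"
    unfolding elems_opens_power_space using u assms(2) by auto
  then show ?thesis
    using code_in_opens[OF is_set_projection_vimage[OF is_set_elems assms(2)]] u by auto
qed

text \<open>That a topology is the coarsest one is an induction principle for its open sets: a property with the
  closure conditions of a topology that holds for the subbasic sets holds for all open sets. It takes
  the place of basic open sets, that is, of finite intersections of subbasic ones.\<close>

lemma power_space_open_induct [consumes 1, case_names definable empty whole Int Union projection]:
  assumes "is_open (power_space E J) W" and "definable (\<lambda>e. Q (elems (e 0)))"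
    and "Q {}" and "Q (funs J (pts E))"
    and "\<And>U V. Q U \<Longrightarrow> Q V \<Longrightarrow> Q (U \<inter> V)"
    and "\<And>S. (\<And>U. U \<in> elems S \<Longrightarrow> Q (elems U)) \<Longrightarrow> Q (\<Union>U\<in>elems S. elems U)"
    and "\<And>j U. j \<in> elems J \<Longrightarrow> is_open E U \<Longrightarrow> Q {f\<in>funs J (pts E). app f j \<in> U}"
  shows "Q W"
proof -
  let ?P = "code (funs J (pts E))"
  obtain T where T: "elems T = {W\<in>elems (pow ?P). Q (elems W)}"
    using is_set_Collect[OF assms(2), of "pow ?P"] by (auto simp: is_set_def)
  obtain w where w: "w \<in> elems (opens (power_space E J))" "elems w = W"
    using assms(1) by (auto simp: is_open_def)
  have "top_space (Space ?P T)"
    unfolding top_space_def T using assms(3-6) by (auto simp: T)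
  moreover have "code {f\<in>funs J (pts E). app f j \<in> elems U} \<in> elems T"
    if "j \<in> elems J" "U \<in> elems (opens E)" for j U
    using is_set_projection_vimage[OF is_set_elems that(1), of "pts E" U] assms(7)[OF that(1), of "elems U"] that(2)
    by (auto simp: T elems_code is_open_elems)
  ultimately have "w \<in> elems T" using w(1) unfolding elems_opens_power_space by blast
  then show ?thesis using T w(2) by simp
qed

section \<open>Clopen sets, finite intersections and countable intersections\<close>

definition Hausdorff :: "'v space \<Rightarrow> bool" where
  "Hausdorff X \<longleftrightarrow> (\<forall>a\<in>elems (pts X). \<forall>b\<in>elems (pts X). a \<noteq> b \<longrightarrow>
     (\<exists>U V. is_open X U \<and> is_open X V \<and> a \<in> U \<and> b \<in> V \<and> U \<inter> V = {}))"

lemma is_set_cmaps: "is_set (cmaps X Y)"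
proof -
  let ?Q = "\<lambda>f. \<forall>V\<in>elems (opens Y). \<exists>U\<in>elems (opens X). \<forall>x. x \<in> elems U \<longleftrightarrow>
      x \<in> elems (pts X) \<and> (\<exists>v\<in>elems V. opair x v \<in> elems f)"
  have "definable (\<lambda>e. ?Q (e 0))" by (intro definable_intros)
  then have "is_set {f\<in>elems (code (funs (pts X) (pts Y))). ?Q f}" by (rule is_set_Collect)
  moreover have "?Q f \<longleftrightarrow> f \<in> cmaps X Y" if f: "f \<in> funs (pts X) (pts Y)" for f
  proof -
    have "x \<in> elems (pts X) \<and> (\<exists>v\<in>elems V. opair x v \<in> elems f) \<longleftrightarrow>
        x \<in> {x\<in>elems (pts X). app f x \<in> elems V}" for x V
      by (auto simp: opair_mem_fun[OF f])
    then have "?Q f \<longleftrightarrow> (\<forall>V\<in>elems (opens Y). is_open X {x\<in>elems (pts X). app f x \<in> elems V})"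
      unfolding is_open_def set_eq_iff by simp
    also have "\<dots> \<longleftrightarrow> (\<forall>V. is_open Y V \<longrightarrow> is_open X {x\<in>elems (pts X). app f x \<in> V})"
      by (auto simp: is_open_def[of Y])
    finally show ?thesis using f by (simp add: cmaps_iff)
  qed
  ultimately have "is_set {f\<in>funs (pts X) (pts Y). f \<in> cmaps X Y}"
    by (simp cong: conj_cong)
  moreover have "{f\<in>funs (pts X) (pts Y). f \<in> cmaps X Y} = cmaps X Y"
    using cmaps_funs by blast
  ultimately show ?thesis by simp
qed

text \<open>Finiteness is that of the model, so the proof is an induction along the \<open>\<omega>\<close> of the model.\<close>

lemma finite_Inter_open:
  assumes "top_space X" "f \<in> funs a (opens X)" "m \<in> elems omega" "elems m \<subseteq> elems a"
  shows "is_open X {x\<in>elems (pts X). \<forall>i\<in>elems m. x \<in> elems (app f i)}"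
proof -
  note f = opair_mem_fun[OF assms(2)]
  have *: "(\<forall>i\<in>elems m. \<forall>V. opair i V \<in> elems f \<longrightarrow> x \<in> elems V) \<longleftrightarrow> (\<forall>i\<in>elems m. x \<in> elems (app f i))"
    if "elems m \<subseteq> elems a" for m x
    using that by (auto simp: f)
  have "elems m \<subseteq> elems a \<longrightarrow> (\<exists>U\<in>elems (opens X). \<forall>x. x \<in> elems U \<longleftrightarrow>
      x \<in> elems (pts X) \<and> (\<forall>i\<in>elems m. \<forall>V. opair i V \<in> elems f \<longrightarrow> x \<in> elems V))"
    using assms(3)
  proof (induction m rule: omega_induct)
    case definable
    show ?case by (intro definable_intros)
  next
    case zero
    show ?case using assms(1) unfolding top_space_def by auto
  next
    case (succ m)
    show ?case
    proof
      assume sub: "elems (succ m) \<subseteq> elems a"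
      then obtain U where U: "U \<in> elems (opens X)"
        "\<And>x. x \<in> elems U \<longleftrightarrow> x \<in> elems (pts X) \<and> (\<forall>i\<in>elems m. \<forall>V. opair i V \<in> elems f \<longrightarrow> x \<in> elems V)"
        using succ by auto
      have "app f m \<in> elems (opens X)" using sub app_in[OF assms(2)] by auto
      then have "is_open X (elems U \<inter> elems (app f m))"
        using U(1) assms(1) is_open_Int by (simp add: is_open_elems)
      then obtain W where "W \<in> elems (opens X)" "elems W = elems U \<inter> elems (app f m)"
        by (auto simp: is_open_def)
      then show "\<exists>U\<in>elems (opens X). \<forall>x. x \<in> elems U \<longleftrightarrow>
          x \<in> elems (pts X) \<and> (\<forall>i\<in>elems (succ m). \<forall>V. opair i V \<in> elems f \<longrightarrow> x \<in> elems V)"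
        using U(2) sub by (intro bexI[of _ W]) (auto simp: f)
    qed
  qed
  then show ?thesis using assms(4) *[OF assms(4)] unfolding is_open_def by auto
qed

definition clopen :: "'v space \<Rightarrow> 'v set \<Rightarrow> bool" where
  "clopen X V \<longleftrightarrow> is_open X V \<and> is_open X (elems (pts X) - V)"

text \<open>A form without set formation, from which definability can be read off.\<close>

lemma clopen_elems_iff:
  "clopen X (elems V) \<longleftrightarrow> V \<in> elems (opens X) \<and>
     (\<exists>W\<in>elems (opens X). \<forall>z. z \<in> elems W \<longleftrightarrow> z \<in> elems (pts X) \<and> z \<notin> elems V)"
  by (auto simp: clopen_def is_open_elems is_open_def[of X "_ - _"])

lemma clopen_Int:
  assumes "top_space X" "clopen X U" "clopen X V"
  shows "clopen X (U \<inter> V)"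
proof -
  obtain u v where uv: "elems u = U" "elems v = V" using assms by (auto simp: clopen_def is_open_def)
  have "is_set (elems (pts X) - (U \<inter> V))"
    using elems_Diff[of "pts X" "code (elems u \<inter> elems v)"] uv unfolding elems_Int by (metis is_set_elems)
  then have "is_open X (elems (pts X) - (U \<inter> V))"
    using assms by (intro is_openI) (auto simp: clopen_def)
  then show ?thesis using assms is_open_Int by (auto simp: clopen_def)
qed

text \<open>The sequence of open sets is defined by \<open>\<phi>\<close> and not chosen, since an open set is determined by its
  points.\<close>

lemma G_deltaI:
  assumes "definable (\<lambda>e. \<phi> (e 1) (e 0))"
    and "\<And>n. n \<in> elems omega \<Longrightarrow> is_open X {x\<in>elems (pts X). \<phi> n x}"
    and "elems A = {x\<in>elems (pts X). \<forall>n\<in>elems omega. \<phi> n x}"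
  shows "G_delta X A"
proof -
  obtain g where g: "g \<in> funs omega (opens X)"
    "\<And>n. n \<in> elems omega \<Longrightarrow> \<forall>x. x \<in> elems (app g n) \<longleftrightarrow> x \<in> elems (pts X) \<and> \<phi> n x"
  proof (rule function_exists[of "\<lambda>n U. \<forall>x. x \<in> elems U \<longleftrightarrow> x \<in> elems (pts X) \<and> \<phi> n x" omega "opens X"])
    show "definable (\<lambda>e. \<forall>x. x \<in> elems (e 1) \<longleftrightarrow> x \<in> elems (pts X) \<and> \<phi> (e 0) x)"
      by (intro definable_intros) (use assms(1) in simp)
    show "\<exists>U. U \<in> elems (opens X) \<and> (\<forall>x. x \<in> elems U \<longleftrightarrow> x \<in> elems (pts X) \<and> \<phi> n x)"
      if "n \<in> elems omega" for n
      using assms(2)[OF that] unfolding is_open_def by auto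
    show "U = V" if "\<forall>x. x \<in> elems U \<longleftrightarrow> x \<in> elems (pts X) \<and> \<phi> n x"
      "\<forall>x. x \<in> elems V \<longleftrightarrow> x \<in> elems (pts X) \<and> \<phi> n x" for n U V
      using that by (intro extensionality) blast
  qed blast
  moreover have "elems A = (\<Inter>n\<in>elems omega. elems (app g n))"
    using g(2) zero_in_omega unfolding assms(3) by blast
  ultimately show ?thesis unfolding G_delta_def by blast
qed

lemma G_delta_vimage:
  assumes "f \<in> cmaps X Y" "G_delta Y B" "elems A = {x\<in>elems (pts X). app f x \<in> elems B}"
  shows "G_delta X A"
proof -
  obtain g where g: "g \<in> funs omega (opens Y)" "elems B = (\<Inter>n\<in>elems omega. elems (app g n))"
    using assms(2) unfolding G_delta_def by blast
  note f = opair_mem_fun[OF cmaps_funs[OF assms(1)]]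
  let ?\<phi> = "\<lambda>n x. \<exists>U y. opair n U \<in> elems g \<and> opair x y \<in> elems f \<and> y \<in> elems U"
  have \<phi>: "?\<phi> n x \<longleftrightarrow> app f x \<in> elems (app g n)" if "n \<in> elems omega" "x \<in> elems (pts X)" for n x
    using that by (auto simp: f opair_mem_fun[OF g(1)])
  show ?thesis
  proof (rule G_deltaI)
    show "definable (\<lambda>e. ?\<phi> (e 1) (e 0))" by (intro definable_intros)
    show "is_open X {x\<in>elems (pts X). ?\<phi> n x}" if "n \<in> elems omega" for n
    proof -
      have "is_open Y (elems (app g n))" using app_in[OF g(1) that] by (simp add: is_open_elems)
      from cmaps_vimage[OF assms(1) this] show ?thesis using \<phi>[OF that] by (simp cong: conj_cong)
    qed
    show "elems A = {x\<in>elems (pts X). \<forall>n\<in>elems omega. ?\<phi> n x}"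
      using \<phi> unfolding assms(3) g(2) by blast
  qed
qed

end

section \<open>The real line of the model\<close>

locale ZF_reals = ZF mem for mem :: "'v \<Rightarrow> 'v \<Rightarrow> bool" +
  fixes \<R> :: "'v ofield"
  assumes reals: "real_numbers \<R>"
begin

abbreviation reals_set :: "'v set" ("C") where
  "C \<equiv> elems (fcarrier \<R>)"

abbreviation plus :: "'v \<Rightarrow> 'v \<Rightarrow> 'v" (infixl "\<^bold>+" 65) where
  "x \<^bold>+ y \<equiv> app (fadd \<R>) (opair x y)"

abbreviation less :: "'v \<Rightarrow> 'v \<Rightarrow> bool" (infix "\<prec>" 50) where
  "x \<prec> y \<equiv> less_of \<R> x y"

abbreviation null :: 'v ("\<^bold>0") where
  "\<^bold>0 \<equiv> fzero \<R>"

sublocale F: field "ring_of \<R>"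
  using reals by (simp add: real_numbers_def)

lemma ring_of_simps [simp]:
  "carrier (ring_of \<R>) = C" "\<zero>\<^bsub>ring_of \<R>\<^esub> = \<^bold>0" "x \<oplus>\<^bsub>ring_of \<R>\<^esub> y = x \<^bold>+ y"
  "x \<otimes>\<^bsub>ring_of \<R>\<^esub> y = app (fmult \<R>) (opair x y)"
  by (simp_all add: ring_of_def)

lemma fadd_funs: "fadd \<R> \<in> funs (cprod (fcarrier \<R>) (fcarrier \<R>)) (fcarrier \<R>)"
  and fmult_funs: "fmult \<R> \<in> funs (cprod (fcarrier \<R>) (fcarrier \<R>)) (fcarrier \<R>)"
  using reals by (simp_all add: real_numbers_def)

lemma plus_closed [simp]: "x \<in> C \<Longrightarrow> y \<in> C \<Longrightarrow> x \<^bold>+ y \<in> C"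
  using F.a_closed[of x y] by simp

lemma null_closed [simp]: "\<^bold>0 \<in> C"
  using F.zero_closed by simp

lemma plus_assoc: "x \<in> C \<Longrightarrow> y \<in> C \<Longrightarrow> z \<in> C \<Longrightarrow> x \<^bold>+ y \<^bold>+ z = x \<^bold>+ (y \<^bold>+ z)"
  using F.a_assoc[of x y z] by simp

lemma plus_comm: "x \<in> C \<Longrightarrow> y \<in> C \<Longrightarrow> x \<^bold>+ y = y \<^bold>+ x"
  using F.a_comm[of x y] by simp

lemma plus_null [simp]: "x \<in> C \<Longrightarrow> x \<^bold>+ \<^bold>0 = x" "x \<in> C \<Longrightarrow> \<^bold>0 \<^bold>+ x = x"
  using F.r_zero[of x] F.l_zero[of x] by simp_all

lemma neg_exists: "x \<in> C \<Longrightarrow> \<exists>y\<in>C. x \<^bold>+ y = \<^bold>0"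
  using F.r_neg[of x] F.a_inv_closed[of x] by auto

lemma less_irrefl: "x \<in> C \<Longrightarrow> \<not> x \<prec> x"
  and less_total: "x \<in> C \<Longrightarrow> y \<in> C \<Longrightarrow> x = y \<or> x \<prec> y \<or> y \<prec> x"
  and less_trans: "x \<in> C \<Longrightarrow> y \<in> C \<Longrightarrow> z \<in> C \<Longrightarrow> x \<prec> y \<Longrightarrow> y \<prec> z \<Longrightarrow> x \<prec> z"
  and plus_mono: "x \<in> C \<Longrightarrow> y \<in> C \<Longrightarrow> z \<in> C \<Longrightarrow> x \<prec> y \<Longrightarrow> x \<^bold>+ z \<prec> y \<^bold>+ z"
proof -
  note r = reals[unfolded real_numbers_def ring_of_simps, THEN conjunct2, THEN conjunct2, THEN conjunct2, THEN conjunct2]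
  show "x \<in> C \<Longrightarrow> \<not> x \<prec> x" by (rule r[THEN conjunct1, rule_format])
  show "x \<in> C \<Longrightarrow> y \<in> C \<Longrightarrow> x = y \<or> x \<prec> y \<or> y \<prec> x"
    by (rule r[THEN conjunct2, THEN conjunct1, rule_format])
  note r' = r[THEN conjunct2, THEN conjunct2, THEN conjunct1, THEN bspec, THEN bspec, THEN bspec]
  show "x \<in> C \<Longrightarrow> y \<in> C \<Longrightarrow> z \<in> C \<Longrightarrow> x \<prec> y \<Longrightarrow> y \<prec> z \<Longrightarrow> x \<prec> z"
    by (rule r'[THEN conjunct1, THEN mp, OF _ _ _ conjI])
  show "x \<in> C \<Longrightarrow> y \<in> C \<Longrightarrow> z \<in> C \<Longrightarrow> x \<prec> y \<Longrightarrow> x \<^bold>+ z \<prec> y \<^bold>+ z"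
    by (rule r'[THEN conjunct2, THEN conjunct1, THEN mp])
qed

lemma less_closed: "x \<prec> y \<Longrightarrow> x \<in> C \<and> y \<in> C"
proof -
  assume "x \<prec> y"
  then have "opair x y \<in> elems (cprod (fcarrier \<R>) (fcarrier \<R>))"
    using reals[unfolded real_numbers_def, THEN conjunct2, THEN conjunct2, THEN conjunct1]
    unfolding less_of_def by (rule subsetD[rotated])
  then show ?thesis by (simp only: opair_mem_cprod)
qed

lemma less_asym: "x \<prec> y \<Longrightarrow> \<not> y \<prec> x"
  using less_irrefl less_trans less_closed by blast

lemma complete:
  assumes "elems S \<subseteq> C" "elems S \<noteq> {}" "b \<in> C" "\<And>x. x \<in> elems S \<Longrightarrow> \<not> b \<prec> x"
  obtains s where "s \<in> C" "\<And>x. x \<in> elems S \<Longrightarrow> \<not> s \<prec> x"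
    "\<And>c. c \<in> C \<Longrightarrow> (\<And>x. x \<in> elems S \<Longrightarrow> \<not> c \<prec> x) \<Longrightarrow> \<not> c \<prec> s"
proof -
  have "\<forall>S. elems S \<subseteq> C \<and> elems S \<noteq> {} \<and> (\<exists>b\<in>C. \<forall>x\<in>elems S. \<not> b \<prec> x) \<longrightarrow>
        (\<exists>b\<in>C. (\<forall>x\<in>elems S. \<not> b \<prec> x) \<and> (\<forall>c\<in>C. (\<forall>x\<in>elems S. \<not> c \<prec> x) \<longrightarrow> \<not> c \<prec> b))"
    by (rule reals[unfolded real_numbers_def, THEN conjunct2, THEN conjunct2, THEN conjunct2, THEN conjunct2,
          THEN conjunct2, THEN conjunct2, THEN conjunct2])
  then have "elems S \<subseteq> C \<and> elems S \<noteq> {} \<and> (\<exists>b\<in>C. \<forall>x\<in>elems S. \<not> b \<prec> x) \<longrightarrow>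
        (\<exists>b\<in>C. (\<forall>x\<in>elems S. \<not> b \<prec> x) \<and> (\<forall>c\<in>C. (\<forall>x\<in>elems S. \<not> c \<prec> x) \<longrightarrow> \<not> c \<prec> b))"
    by (rule spec)
  moreover have "elems S \<subseteq> C \<and> elems S \<noteq> {} \<and> (\<exists>b\<in>C. \<forall>x\<in>elems S. \<not> b \<prec> x)"
    by (intro conjI bexI[of _ b] ballI assms)
  ultimately have "\<exists>b\<in>C. (\<forall>x\<in>elems S. \<not> b \<prec> x) \<and> (\<forall>c\<in>C. (\<forall>x\<in>elems S. \<not> c \<prec> x) \<longrightarrow> \<not> c \<prec> b)"
    by (rule mp)
  then show thesis
    by (elim bexE conjE) (rule that, assumption, erule bspec, auto)
qed

lemma difference_exists:
  assumes "x \<in> C" "y \<in> C"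
  obtains d where "d \<in> C" "x \<^bold>+ d = y"
proof -
  obtain m where m: "m \<in> C" "x \<^bold>+ m = \<^bold>0" using neg_exists[OF assms(1)] by blast
  then have "x \<^bold>+ (m \<^bold>+ y) = y" using assms by (simp flip: plus_assoc)
  then show thesis using that[of "m \<^bold>+ y"] m(1) assms by simp
qed

lemma plus_less_cancel:
  assumes "x \<in> C" "y \<in> C" "z \<in> C"
  shows "x \<^bold>+ z \<prec> y \<^bold>+ z \<longleftrightarrow> x \<prec> y"
  using plus_mono[of x y z] plus_mono[of y x z] less_total[of x y] less_asym less_irrefl assms plus_closed
  by metis

lemma less_plus_iff: "x \<in> C \<Longrightarrow> d \<in> C \<Longrightarrow> x \<prec> x \<^bold>+ d \<longleftrightarrow> \<^bold>0 \<prec> d"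
  using plus_less_cancel[of "\<^bold>0" d x] by (simp add: plus_comm[of d x])

text \<open>Either 1 or its negative is positive.\<close>

lemma positive_exists: "\<exists>e\<in>C. \<^bold>0 \<prec> e"
proof -
  have one: "\<one>\<^bsub>ring_of \<R>\<^esub> \<in> C" "\<one>\<^bsub>ring_of \<R>\<^esub> \<noteq> \<^bold>0"
    using F.one_closed F.one_not_zero by simp_all
  obtain m where m: "m \<in> C" "\<one>\<^bsub>ring_of \<R>\<^esub> \<^bold>+ m = \<^bold>0" using neg_exists one by blast
  show ?thesis
  proof (cases "\<^bold>0 \<prec> \<one>\<^bsub>ring_of \<R>\<^esub>")
    case False
    then have "\<one>\<^bsub>ring_of \<R>\<^esub> \<prec> \<^bold>0" using less_total[of "\<^bold>0" "\<one>\<^bsub>ring_of \<R>\<^esub>"] one by auto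
    then have "\<^bold>0 \<prec> m" using less_plus_iff[of "\<one>\<^bsub>ring_of \<R>\<^esub>" m] one m by simp
    then show ?thesis using m by blast
  qed (use one in blast)
qed

lemma double_pos_iff:
  assumes "x \<in> C"
  shows "\<^bold>0 \<prec> x \<^bold>+ x \<longleftrightarrow> \<^bold>0 \<prec> x"
proof -
  have a: "\<^bold>0 \<prec> x \<Longrightarrow> \<^bold>0 \<prec> x \<^bold>+ x"
    using less_plus_iff[of x x] less_trans[of "\<^bold>0" x "x \<^bold>+ x"] assms by simp
  have "x \<prec> \<^bold>0 \<Longrightarrow> x \<^bold>+ x \<prec> \<^bold>0"
    using plus_mono[of x "\<^bold>0" x] less_trans[of "x \<^bold>+ x" x "\<^bold>0"] assms by simp
  then show ?thesis
    using a less_total[of "\<^bold>0" x] less_asym[of "x \<^bold>+ x" "\<^bold>0"] less_irrefl[of "\<^bold>0"] assms by auto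
qed

text \<open>Twice 1 is not zero, since doubling preserves signs; hence it has an inverse.\<close>

lemma halving_exists:
  obtains H where "H \<in> funs (fcarrier \<R>) (fcarrier \<R>)" "\<And>x. x \<in> C \<Longrightarrow> app H x \<^bold>+ app H x = x"
proof -
  let ?one = "\<one>\<^bsub>ring_of \<R>\<^esub>"
  let ?two = "?one \<oplus>\<^bsub>ring_of \<R>\<^esub> ?one"
  have one: "?one \<in> C" "?one \<noteq> \<^bold>0" using F.one_closed F.one_not_zero by simp_all
  have "?two \<noteq> \<^bold>0"
  proof
    assume two: "?two = \<^bold>0"
    have "\<not> \<^bold>0 \<prec> ?one" using double_pos_iff[OF one(1)] two less_irrefl[of "\<^bold>0"] by simp
    then have "?one \<prec> \<^bold>0" using one less_total[of "\<^bold>0" ?one] by auto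
    then have "\<^bold>0 \<prec> ?one" using less_plus_iff[of ?one ?one] one two by simp
    then show False using \<open>\<not> \<^bold>0 \<prec> ?one\<close> by simp
  qed
  then have "?two \<in> Units (ring_of \<R>)" using F.field_Units one(1) by simp
  then obtain h where h: "h \<in> C" "h \<otimes>\<^bsub>ring_of \<R>\<^esub> ?two = ?one"
    using F.Units_l_inv F.Units_inv_closed by (metis ring_of_simps(1))
  have hx: "h \<otimes>\<^bsub>ring_of \<R>\<^esub> x \<oplus>\<^bsub>ring_of \<R>\<^esub> h \<otimes>\<^bsub>ring_of \<R>\<^esub> x = x" if "x \<in> C" for x
  proof -
    have "h \<otimes>\<^bsub>ring_of \<R>\<^esub> x \<oplus>\<^bsub>ring_of \<R>\<^esub> h \<otimes>\<^bsub>ring_of \<R>\<^esub> x = (h \<otimes>\<^bsub>ring_of \<R>\<^esub> ?two) \<otimes>\<^bsub>ring_of \<R>\<^esub> x"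
      using h(1) that one(1) F.l_distr[of h h x] F.r_distr[of ?one ?one h] F.r_one[of h] by (simp del: ring_of_simps(3,4))
    also have "\<dots> = x" unfolding h(2) using that by (intro F.l_one) simp
    finally show ?thesis .
  qed
  obtain H where H: "H \<in> funs (fcarrier \<R>) (fcarrier \<R>)"
    "\<And>x. x \<in> C \<Longrightarrow> opair (opair h x) (app H x) \<in> elems (fmult \<R>)"
  proof (rule function_exists[of "\<lambda>x y. opair (opair h x) y \<in> elems (fmult \<R>)" "fcarrier \<R>" "fcarrier \<R>"])
    show "definable (\<lambda>e. opair (opair h (e 0)) (e 1) \<in> elems (fmult \<R>))"
      by (intro definable_intros)
    show "\<exists>y. y \<in> C \<and> opair (opair h x) y \<in> elems (fmult \<R>)" if "x \<in> C" for x
      using F.m_closed[of h x] that h(1) by (simp add: opair_mem_fun[OF fmult_funs])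
  qed (auto simp: opair_mem_fun[OF fmult_funs])
  show thesis
  proof (rule that[OF H(1)])
    show "app H x \<^bold>+ app H x = x" if "x \<in> C" for x
      using H(2)[OF that] hx[OF that] by (simp add: opair_mem_fun[OF fmult_funs])
  qed
qed

lemma less_dense:
  assumes "x \<prec> y"
  obtains c where "x \<prec> c" "c \<prec> y"
proof -
  have C: "x \<in> C" "y \<in> C" using assms less_closed by auto
  obtain d where d: "d \<in> C" "x \<^bold>+ d = y" using difference_exists C by blast
  obtain H where H: "H \<in> funs (fcarrier \<R>) (fcarrier \<R>)" "\<And>x. x \<in> C \<Longrightarrow> app H x \<^bold>+ app H x = x"
    using halving_exists by blast
  define c where "c = app H d"
  have c: "c \<in> C" "c \<^bold>+ c = d" unfolding c_def using H d app_in by auto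
  have "\<^bold>0 \<prec> d" using less_plus_iff[of x d] C d assms by simp
  then have "\<^bold>0 \<prec> c" using double_pos_iff c by metis
  then have "x \<prec> x \<^bold>+ c" "x \<^bold>+ c \<prec> (x \<^bold>+ c) \<^bold>+ c" using less_plus_iff C c(1) by simp_all
  moreover have "(x \<^bold>+ c) \<^bold>+ c = y" using plus_assoc C c d by simp
  ultimately show thesis using that by metis
qed

lemma pts_real_line [simp]: "pts (real_line \<R>) = fcarrier \<R>"
  by (simp add: real_line_def)

lemma is_open_real_line:
  "is_open (real_line \<R>) V \<longleftrightarrow> is_set V \<and> V \<subseteq> C \<and>
     (\<forall>x\<in>V. \<exists>a b. a \<prec> x \<and> x \<prec> b \<and> (\<forall>y. a \<prec> y \<and> y \<prec> b \<longrightarrow> y \<in> V))"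
proof -
  let ?Q = "\<lambda>V. elems V \<subseteq> C \<and> (\<forall>x\<in>elems V. \<exists>a\<in>C. \<exists>b\<in>C. opair a x \<in> elems (fless \<R>) \<and>
     opair x b \<in> elems (fless \<R>) \<and> (\<forall>y. y \<in> C \<and> opair a y \<in> elems (fless \<R>) \<and> opair y b \<in> elems (fless \<R>) \<longrightarrow> y \<in> elems V))"
  have "definable (\<lambda>e. ?Q (e 0))" by (intro definable_intros)
  then have "is_set {V. ?Q V}" by (rule is_set_subset[of _ "pow (fcarrier \<R>)"]) simp
  moreover have "opens (real_line \<R>) = code {V. ?Q V}"
    by (simp add: real_line_def less_of_def subset_eq)
  ultimately have o: "elems (opens (real_line \<R>)) = {V. ?Q V}" by (simp add: elems_code)
  have q: "?Q v \<longleftrightarrow> elems v \<subseteq> C \<and> (\<forall>x\<in>elems v. \<exists>a b. a \<prec> x \<and> x \<prec> b \<and> (\<forall>y. a \<prec> y \<and> y \<prec> b \<longrightarrow> y \<in> elems v))" for v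
    using less_closed unfolding less_of_def by blast
  have "v \<in> elems (opens (real_line \<R>)) \<longleftrightarrow> elems v \<subseteq> C \<and>
      (\<forall>x\<in>elems v. \<exists>a b. a \<prec> x \<and> x \<prec> b \<and> (\<forall>y. a \<prec> y \<and> y \<prec> b \<longrightarrow> y \<in> elems v))" for v
    unfolding o mem_Collect_eq by (rule q)
  then show ?thesis
    unfolding is_open_def is_set_def Bex_def by auto
qed

lemma is_open_interval: "is_open (real_line \<R>) {y. a \<prec> y \<and> y \<prec> b}"
proof -
  have "definable (\<lambda>e. opair a (e 0) \<in> elems (fless \<R>) \<and> opair (e 0) b \<in> elems (fless \<R>))"
    by (intro definable_intros)
  then have "is_set {y. a \<prec> y \<and> y \<prec> b}"
    unfolding less_of_def[abs_def]
    by (rule is_set_subset[of _ "fcarrier \<R>"]) (use less_closed less_of_def in blast)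
  then show ?thesis unfolding is_open_real_line using less_closed by blast
qed

lemma interval_around:
  assumes "x \<in> C"
  shows "\<exists>a b. a \<prec> x \<and> x \<prec> b"
proof -
  obtain e where e: "e \<in> C" "\<^bold>0 \<prec> e" using positive_exists by blast
  obtain a where a: "a \<in> C" "e \<^bold>+ a = x" using difference_exists e assms by blast
  have "a \<prec> a \<^bold>+ e" "x \<prec> x \<^bold>+ e" using less_plus_iff e a assms by auto
  then show ?thesis using a plus_comm e by metis
qed

lemma real_line_Hausdorff:
  assumes "x \<in> C" "y \<in> C" "x \<noteq> y"
  obtains U V where "is_open (real_line \<R>) U" "is_open (real_line \<R>) V" "x \<in> U" "y \<in> V" "U \<inter> V = {}"
proof -
  have *: "\<exists>U V. is_open (real_line \<R>) U \<and> is_open (real_line \<R>) V \<and> x \<in> U \<and> y \<in> V \<and> U \<inter> V = {}"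
    if xy: "x \<prec> y" for x y
  proof -
    obtain c where c: "x \<prec> c" "c \<prec> y" using less_dense[OF xy] by blast
    obtain a b where "a \<prec> x" "y \<prec> b" using interval_around less_closed xy by metis
    then show ?thesis
      using c less_asym is_open_interval[of a c] is_open_interval[of c b]
      by (intro exI[of _ "{t. a \<prec> t \<and> t \<prec> c}"] exI[of _ "{t. c \<prec> t \<and> t \<prec> b}"]) auto
  qed
  consider "x \<prec> y" | "y \<prec> x" using assms less_total by blast
  then show thesis
    by cases (use *[of x y] *[of y x] that in \<open>blast\<close>)+
qed

text \<open>Repeated halving of a positive number. If the terms had a positive lower bound, let \<open>l\<close> be the
  supremum of all lower bounds. Every term is twice the next one, so \<open>l + l\<close> is a lower bound as well,
  which gives \<open>l + l \<le> l\<close> and contradicts \<open>l > 0\<close>.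

  The sequence has two uses: it shrinks the neighbourhoods of a real number to a point, and it embeds
  the natural numbers in the reals.\<close>

lemma vanishing_sequence_exists:
  obtains s where "s \<in> funs omega (fcarrier \<R>)" "\<And>n. n \<in> elems omega \<Longrightarrow> \<^bold>0 \<prec> app s n"
    "\<And>m n. n \<in> elems omega \<Longrightarrow> m \<in> elems n \<Longrightarrow> app s n \<prec> app s m"
    "\<And>\<epsilon>. \<^bold>0 \<prec> \<epsilon> \<Longrightarrow> \<exists>n\<in>elems omega. app s n \<prec> \<epsilon>"
proof -
  obtain H where H: "H \<in> funs (fcarrier \<R>) (fcarrier \<R>)" "\<And>x. x \<in> C \<Longrightarrow> app H x \<^bold>+ app H x = x"
    using halving_exists by blast
  obtain u where u: "u \<in> C" "\<^bold>0 \<prec> u" using positive_exists by blast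
  obtain s where s: "s \<in> funs omega (fcarrier \<R>)" "app s zero = u"
    "\<And>n. n \<in> elems omega \<Longrightarrow> app s (succ n) = app H (app s n)"
    using recursion_exists[OF u(1) H(1)] by blast
  note smem = opair_mem_fun[OF s(1)]
  have sC: "app s n \<in> C" if "n \<in> elems omega" for n using app_in s(1) that by blast
  have double: "app s (succ n) \<^bold>+ app s (succ n) = app s n" if "n \<in> elems omega" for n
    using that s(3) H(2) sC by simp
  have "\<exists>x. opair n x \<in> elems s \<and> opair \<^bold>0 x \<in> elems (fless \<R>)" if "n \<in> elems omega" for n
    using that
  proof (induction n rule: omega_induct)
    case definable
    show ?case by (intro definable_intros)
  next
    case zero
    show ?case using u(2) s(2) by (simp add: smem less_of_def)
  next
    case (succ n)
    then have "\<^bold>0 \<prec> app s (succ n)"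
      using double_pos_iff[of "app s (succ n)"] sC double[of n] by (auto simp: smem less_of_def)
    then show ?case using succ by (simp add: smem less_of_def)
  qed
  then have pos: "\<^bold>0 \<prec> app s n" if "n \<in> elems omega" for n
    using that by (auto simp: smem less_of_def)
  have step: "app s (succ n) \<prec> app s n" if "n \<in> elems omega" for n
    using less_plus_iff[of "app s (succ n)" "app s (succ n)"] pos sC double that by simp
  have "\<forall>m\<in>elems n. \<exists>x y. opair n x \<in> elems s \<and> opair m y \<in> elems s \<and> opair x y \<in> elems (fless \<R>)"
    if "n \<in> elems omega" for n
    using that
  proof (induction n rule: omega_induct)
    case definable
    show ?case by (intro definable_intros)
  next
    case (succ n)
    have "app s (succ n) \<prec> app s m" if "m \<in> elems (succ n)" for m
    proof (cases "m = n")
      case False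
      then have "m \<in> elems n" using that by simp
      then have "app s n \<prec> app s m" using succ by (auto simp: smem less_of_def)
      then show ?thesis using step less_trans less_closed succ by blast
    qed (use step succ in simp)
    then show ?case using succ omega_subset[of "succ n"] by (auto simp: smem less_of_def)
  qed simp
  then have dec: "app s n \<prec> app s m" if "n \<in> elems omega" "m \<in> elems n" for m n
    using that by (auto simp: smem less_of_def)
  have "\<exists>n\<in>elems omega. app s n \<prec> \<epsilon>" if eps: "\<^bold>0 \<prec> \<epsilon>" for \<epsilon>
  proof (rule ccontr)
    assume neg: "\<not> ?thesis"
    have "definable (\<lambda>e. \<forall>n\<in>elems omega. \<forall>y. opair n y \<in> elems s \<longrightarrow> \<not> opair y (e 0) \<in> elems (fless \<R>))"
      by (intro definable_intros)
    then have "is_set {x\<in>C. \<forall>n\<in>elems omega. \<forall>y. opair n y \<in> elems s \<longrightarrow> \<not> opair y x \<in> elems (fless \<R>)}"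
      by (rule is_set_Collect)
    then obtain L where L': "elems L = {x\<in>C. \<forall>n\<in>elems omega. \<forall>y. opair n y \<in> elems s \<longrightarrow> \<not> opair y x \<in> elems (fless \<R>)}"
      by (auto simp: is_set_def)
    then have L: "x \<in> elems L \<longleftrightarrow> x \<in> C \<and> (\<forall>n\<in>elems omega. \<not> app s n \<prec> x)" for x
      by (auto simp: smem less_of_def)
    have "\<epsilon> \<in> elems L" using neg eps less_closed L by blast
    obtain l where l: "l \<in> C" "\<And>x. x \<in> elems L \<Longrightarrow> \<not> l \<prec> x"
      "\<And>c. c \<in> C \<Longrightarrow> (\<And>x. x \<in> elems L \<Longrightarrow> \<not> c \<prec> x) \<Longrightarrow> \<not> c \<prec> l"
    proof (rule complete[of L "app s zero"])
      show "elems L \<noteq> {}" using \<open>\<epsilon> \<in> elems L\<close> by blast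
    qed (use L sC in auto)
    have "\<not> app s n \<prec> l" if "n \<in> elems omega" for n
      using l(3)[OF sC[OF that]] L that by blast
    moreover have "\<not> app s n \<prec> l \<^bold>+ l" if n: "n \<in> elems omega" for n
    proof
      assume less: "app s n \<prec> l \<^bold>+ l"
      define d where "d = app s (succ n)"
      have d: "d \<in> C" "d \<^bold>+ d = app s n" "\<not> d \<prec> l"
        unfolding d_def using n sC double calculation by auto
      then have "l = d \<or> l \<prec> d" using l(1) less_total by blast
      then have "\<not> d \<^bold>+ d \<prec> l \<^bold>+ l"
      proof
        assume "l \<prec> d"
        then have "l \<^bold>+ l \<prec> d \<^bold>+ l" "l \<^bold>+ d \<prec> d \<^bold>+ d" using plus_mono l(1) d(1) by auto
        then have "l \<^bold>+ l \<prec> d \<^bold>+ d" using plus_comm[of d l] less_trans l(1) d(1) plus_closed by metis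
        then show ?thesis using less_asym by blast
      qed (use less_irrefl[OF sC[OF n]] d in auto)
      then show False using less d by simp
    qed
    ultimately have "l \<^bold>+ l \<in> elems L" using L l(1) by simp
    then have "\<not> \<^bold>0 \<prec> l" using l(2) less_plus_iff l(1) by blast
    moreover have "\<^bold>0 \<prec> l"
      using l(1) l(2)[OF \<open>\<epsilon> \<in> elems L\<close>] eps less_total less_trans less_closed by metis
    ultimately show False by blast
  qed
  then show thesis using that s(1) pos dec by blast
qed

text \<open>The point \<open>c\<close> is the intersection of the intervals from \<open>c - s n\<close> to \<open>c + s n\<close> for a sequence \<open>s\<close> of
  positive reals that tends to zero.\<close>

lemma G_delta_real_singleton:
  assumes "c \<in> C"
  shows "G_delta (real_line \<R>) (code {c})"
proof -
  obtain s where s: "s \<in> funs omega (fcarrier \<R>)" "\<And>n. n \<in> elems omega \<Longrightarrow> \<^bold>0 \<prec> app s n"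
    "\<And>\<epsilon>. \<^bold>0 \<prec> \<epsilon> \<Longrightarrow> \<exists>n\<in>elems omega. app s n \<prec> \<epsilon>"
    using vanishing_sequence_exists by metis
  have sC: "app s n \<in> C" if "n \<in> elems omega" for n using app_in s(1) that by blast
  let ?\<phi> = "\<lambda>n t. \<exists>d a b. opair n d \<in> elems s \<and> opair (opair a d) c \<in> elems (fadd \<R>) \<and>
      opair (opair c d) b \<in> elems (fadd \<R>) \<and> opair a t \<in> elems (fless \<R>) \<and> opair t b \<in> elems (fless \<R>)"
  have \<phi>: "?\<phi> n t \<longleftrightarrow> (\<exists>a\<in>C. a \<^bold>+ app s n = c \<and> a \<prec> t \<and> t \<prec> c \<^bold>+ app s n)" if "n \<in> elems omega" for n t
    using that assms sC by (auto simp: opair_mem_fun[OF s(1)] opair_mem_fun[OF fadd_funs] less_of_def)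
  show ?thesis
  proof (rule G_deltaI)
    show "definable (\<lambda>e. ?\<phi> (e 1) (e 0))" by (intro definable_intros)
    fix n assume n: "n \<in> elems omega"
    obtain a where a: "a \<in> C" "a \<^bold>+ app s n = c"
      using difference_exists[OF sC[OF n] assms] plus_comm sC[OF n] by metis
    \<comment> \<open>The left end \<open>a\<close> of the interval is given by \<open>a + s n = c\<close>, which determines it.\<close>
    have uniq: "a' = a" if "a' \<in> C" "a' \<^bold>+ app s n = c" for a'
      using less_total[of a' a] plus_less_cancel[of a' a "app s n"] plus_less_cancel[of a a' "app s n"]
        less_irrefl[of c] a that sC[OF n] assms by auto
    have "?\<phi> n t \<longleftrightarrow> a \<prec> t \<and> t \<prec> c \<^bold>+ app s n" for t
      unfolding \<phi>[OF n] using a uniq by blast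
    moreover have "t \<in> C" if "a \<prec> t" for t using less_closed[OF that] by blast
    ultimately have "{t\<in>elems (pts (real_line \<R>)). ?\<phi> n t} = {t. a \<prec> t \<and> t \<prec> c \<^bold>+ app s n}"
      unfolding pts_real_line by blast
    then show "is_open (real_line \<R>) {t\<in>elems (pts (real_line \<R>)). ?\<phi> n t}"
      using is_open_interval by simp
  next
    have "?\<phi> n c" if n: "n \<in> elems omega" for n
    proof -
      obtain a where a: "a \<in> C" "a \<^bold>+ app s n = c"
        using difference_exists[OF sC[OF n] assms] plus_comm sC[OF n] by metis
      then have "a \<prec> c" "c \<prec> c \<^bold>+ app s n"
        using less_plus_iff[of a "app s n"] less_plus_iff[of c "app s n"] s(2)[OF n] sC[OF n] assms by auto
      then show ?thesis unfolding \<phi>[OF n] using a by blast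
    qed
    moreover have "t = c" if t: "t \<in> C" and all: "\<forall>n\<in>elems omega. ?\<phi> n t" for t
    proof (rule ccontr)
      assume "t \<noteq> c"
      then consider "t \<prec> c" | "c \<prec> t" using less_total assms t by blast
      then show False
      proof cases
        case 1
        obtain \<epsilon> where e: "\<epsilon> \<in> C" "t \<^bold>+ \<epsilon> = c" using difference_exists t assms by blast
        then have "\<^bold>0 \<prec> \<epsilon>" using less_plus_iff[of t \<epsilon>] t 1 by simp
        then obtain n where n: "n \<in> elems omega" "app s n \<prec> \<epsilon>" using s(3) by blast
        obtain a where a: "a \<in> C" "a \<^bold>+ app s n = c" "a \<prec> t" using all n(1) \<phi>[OF n(1)] by blast
        have "a \<^bold>+ app s n \<prec> t \<^bold>+ app s n" using plus_mono a t sC n by blast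
        moreover have "t \<^bold>+ app s n \<prec> t \<^bold>+ \<epsilon>"
          using plus_mono[OF sC[OF n(1)] e(1) t n(2)] plus_comm t e(1) sC[OF n(1)] by simp
        ultimately show False using a(2) e(2) less_asym by metis
      next
        case 2
        obtain \<epsilon> where e: "\<epsilon> \<in> C" "c \<^bold>+ \<epsilon> = t" using difference_exists t assms by blast
        then have "\<^bold>0 \<prec> \<epsilon>" using less_plus_iff[of c \<epsilon>] assms 2 by simp
        then obtain n where n: "n \<in> elems omega" "app s n \<prec> \<epsilon>" using s(3) by blast
        have "t \<prec> c \<^bold>+ app s n" using all n(1) \<phi>[OF n(1)] by blast
        moreover have "c \<^bold>+ app s n \<prec> c \<^bold>+ \<epsilon>"
          using plus_mono[OF sC[OF n(1)] e(1) assms n(2)] plus_comm assms e(1) sC[OF n(1)] by simp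
        ultimately show False using e(2) less_asym by metis
      qed
    qed
    ultimately show "elems (code {c}) = {t\<in>elems (pts (real_line \<R>)). \<forall>n\<in>elems omega. ?\<phi> n t}"
      using assms by auto
  qed
qed

lemma Tychonoff_separation:
  assumes "Tychonoff \<R> E" "is_open E U" "x \<in> U"
  obtains f where "f \<in> cmaps E (real_line \<R>)" "app f x \<noteq> \<^bold>0"
    "\<And>y. y \<in> elems (pts E) \<Longrightarrow> app f y \<noteq> \<^bold>0 \<Longrightarrow> y \<in> U"
proof -
  obtain u where u: "u \<in> elems (opens E)" "elems u = U" using assms(2) by (auto simp: is_open_def)
  have "is_base E {code (elems (pts E) - elems Z) | Z. zero_set \<R> E Z}"
    using assms(1) by (simp only: Tychonoff_def)
  moreover have "x \<in> elems u" using assms(3) u(2) by simp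
  ultimately obtain B where B: "B \<in> {code (elems (pts E) - elems Z) | Z. zero_set \<R> E Z}"
    "x \<in> elems B" "elems B \<subseteq> elems u"
    unfolding is_base_def by (elim conjE) (drule bspec[OF _ u(1)], drule bspec, assumption, elim bexE conjE)
  then obtain Z where "zero_set \<R> E Z" "B = code (elems (pts E) - elems Z)" by blast
  then have Z: "zero_set \<R> E Z" "x \<in> elems (pts E) - elems Z" "elems (pts E) - elems Z \<subseteq> U"
    using B u by simp_all
  then obtain f where "f \<in> cmaps E (real_line \<R>)" "elems Z = {x\<in>elems (pts E). app f x = \<^bold>0}"
    unfolding zero_set_def by blast
  then show thesis using that Z by blast
qed

text \<open>By \<open>T\<^sub>1\<close> and the base of cozero sets, a real function vanishes at \<open>b\<close> but not at \<open>a\<close>; disjoint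
  neighbourhoods of its two values are pulled back.\<close>

lemma Tychonoff_Hausdorff:
  assumes "Tychonoff \<R> E"
  shows "Hausdorff E"
  unfolding Hausdorff_def
proof (intro ballI impI)
  fix a b assume ab: "a \<in> elems (pts E)" "b \<in> elems (pts E)" "a \<noteq> b"
  have "is_open E (elems (pts E) - {b})"
    using assms ab(2) unfolding Tychonoff_def T1_space_def by (auto simp: closed_in_iff)
  then obtain f where f: "f \<in> cmaps E (real_line \<R>)" "app f a \<noteq> \<^bold>0"
    "\<And>y. y \<in> elems (pts E) \<Longrightarrow> app f y \<noteq> \<^bold>0 \<Longrightarrow> y \<in> elems (pts E) - {b}"
    using Tychonoff_separation[OF assms, of _ a] ab by blast
  then have "app f b = \<^bold>0" using ab by blast
  moreover have "app f a \<in> C" "app f b \<in> C" using cmaps_app[OF f(1)] ab by auto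
  ultimately obtain U V where "is_open (real_line \<R>) U" "is_open (real_line \<R>) V"
    "app f a \<in> U" "app f b \<in> V" "U \<inter> V = {}"
    using real_line_Hausdorff f(2) by metis
  then show "\<exists>U V. is_open E U \<and> is_open E V \<and> a \<in> U \<and> b \<in> V \<and> U \<inter> V = {}"
    using cmaps_vimage[OF f(1)] ab
    by (intro exI[of _ "{x\<in>elems (pts E). app f x \<in> U}"] exI[of _ "{x\<in>elems (pts E). app f x \<in> V}"]) auto
qed

text \<open>Codes by a real number when a point leaves the sequence \<open>V\<close> for the first time; the value \<open>0\<close> stands for
  never. Both the least index and its uniqueness come from the order of \<open>\<omega>\<close>.\<close>

lemma first_exit_function:
  assumes V: "V \<in> funs omega D"
    and s: "s \<in> funs omega (fcarrier \<R>)"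
    and inj: "\<And>m n. n \<in> elems omega \<Longrightarrow> m \<in> elems n \<Longrightarrow> app s n \<noteq> app s m"
  obtains k where "k \<in> funs a (fcarrier \<R>)"
    "\<And>y m. y \<in> elems a \<Longrightarrow> m \<in> elems omega \<Longrightarrow> y \<notin> elems (app V m) \<Longrightarrow>
       (\<And>i. i \<in> elems m \<Longrightarrow> y \<in> elems (app V i)) \<Longrightarrow> app k y = app s m"
    "\<And>y. y \<in> elems a \<Longrightarrow> (\<And>i. i \<in> elems omega \<Longrightarrow> y \<in> elems (app V i)) \<Longrightarrow> app k y = \<^bold>0"
proof -
  note V_mem = opair_mem_fun[OF V] and s_mem = opair_mem_fun[OF s]
  let ?\<phi> = "\<lambda>y r. (\<exists>m\<in>elems omega. (\<exists>U. opair m U \<in> elems V \<and> y \<notin> elems U) \<and>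
        (\<forall>i\<in>elems m. \<forall>U. opair i U \<in> elems V \<longrightarrow> y \<in> elems U) \<and> opair m r \<in> elems s) \<or>
      ((\<forall>i\<in>elems omega. \<forall>U. opair i U \<in> elems V \<longrightarrow> y \<in> elems U) \<and> r = \<^bold>0)"
  have \<phi>: "?\<phi> y r \<longleftrightarrow> (\<exists>m\<in>elems omega. y \<notin> elems (app V m) \<and> (\<forall>i\<in>elems m. y \<in> elems (app V i)) \<and> r = app s m) \<or>
      ((\<forall>i\<in>elems omega. y \<in> elems (app V i)) \<and> r = \<^bold>0)" for y r
  proof -
    have "(\<forall>i\<in>elems m. \<forall>U. opair i U \<in> elems V \<longrightarrow> y \<in> elems U) \<longleftrightarrow> (\<forall>i\<in>elems m. y \<in> elems (app V i))"
      if "m \<in> elems omega" for m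
      using omega_subset[OF that] by (auto simp: V_mem)
    then show ?thesis by (auto simp: V_mem s_mem)
  qed
  have least_unique: "m = n"
    if "m \<in> elems omega" "y \<notin> elems (app V m)" "\<forall>i\<in>elems m. y \<in> elems (app V i)"
      "n \<in> elems omega" "y \<notin> elems (app V n)" "\<forall>i\<in>elems n. y \<in> elems (app V i)" for m n y
    using omega_trichotomy[OF that(1,4)] that by blast
  obtain k where k: "k \<in> funs a (fcarrier \<R>)" "\<And>y. y \<in> elems a \<Longrightarrow> ?\<phi> y (app k y)"
  proof (rule function_exists[of ?\<phi> a "fcarrier \<R>"])
    show "definable (\<lambda>e. ?\<phi> (e 0) (e 1))" by (intro definable_intros)
    show "\<exists>r. r \<in> C \<and> ?\<phi> y r" for y
      using least_missing_index[OF V, of y] app_in[OF s] null_closed unfolding \<phi> by blast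
    show "r = r'" if "?\<phi> y r" "?\<phi> y r'" for y r r'
      using that unfolding \<phi> using least_unique by blast
  qed (rule that)
  show thesis
  proof (rule that[OF k(1)])
    fix y assume y: "y \<in> elems a"
    show "app k y = app s m" if "m \<in> elems omega" "y \<notin> elems (app V m)" "\<And>i. i \<in> elems m \<Longrightarrow> y \<in> elems (app V i)" for m
      using k(2)[OF y] that least_unique unfolding \<phi> by blast
    show "app k y = \<^bold>0" if "\<And>i. i \<in> elems omega \<Longrightarrow> y \<in> elems (app V i)"
      using k(2)[OF y] that unfolding \<phi> by blast
  qed
qed

end

section \<open>The Hewitt extension of a P-space\<close>

locale Hewitt_P = ZF_reals mem \<R> for mem :: "'v \<Rightarrow> 'v \<Rightarrow> bool" and \<R> :: "'v ofield" +
  fixes E X Y :: "'v space" and h :: 'v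
  assumes Tychonoff_E: "Tychonoff \<R> E"
    and E_compact_reals: "E_compact E (discrete (fcarrier \<R>))"
    and P_space_X: "P_space X"
    and Hewitt: "Hewitt_extension E X Y h"
begin

lemma top_X: "top_space X"
  using P_space_X by (simp add: P_space_def)

lemma top_Y: "top_space Y"
  using Hewitt by (simp add: Hewitt_extension_def extension_def)

lemma h_funs: "h \<in> funs (pts X) (pts Y)"
  using Hewitt by (simp add: Hewitt_extension_def extension_def)

lemma h_in [simp]: "x \<in> elems (pts X) \<Longrightarrow> app h x \<in> elems (pts Y)"
  using h_funs app_in by blast

lemma h_cmaps: "h \<in> cmaps X Y"
  unfolding cmaps_iff
proof (intro conjI allI impI h_funs)
  fix V assume V: "is_open Y V"
  let ?I = "image_set h (pts X)"
  have "h \<in> cmaps X (subspace Y ?I)"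
    using Hewitt by (simp add: Hewitt_extension_def extension_def homeomorphism_def)
  moreover have "is_open (subspace Y ?I) (V \<inter> elems ?I)"
    using V by (auto simp: is_open_subspace)
  ultimately have "is_open X {x\<in>elems (pts X). app h x \<in> V \<inter> elems ?I}"
    by (rule cmaps_vimage)
  moreover have "{x\<in>elems (pts X). app h x \<in> V \<inter> elems ?I} = {x\<in>elems (pts X). app h x \<in> V}"
    using elems_image_set[OF h_funs] by auto
  ultimately show "is_open X {x\<in>elems (pts X). app h x \<in> V}" by simp
qed

lemma dense:
  assumes "is_open Y V" "y \<in> V"
  obtains x where "x \<in> elems (pts X)" "app h x \<in> V"
proof -
  have "dense_in Y (image_set h (pts X))"
    using Hewitt by (simp add: Hewitt_extension_def extension_def)
  then have "V \<inter> app h ` elems (pts X) \<noteq> {}"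
    using assms unfolding dense_in_def elems_image_set[OF h_funs] is_open_def by blast
  then show thesis using that by blast
qed

lemma extend: "f \<in> cmaps X E \<Longrightarrow> \<exists>g\<in>cmaps Y E. \<forall>x\<in>elems (pts X). app g (app h x) = app f x"
  using Hewitt by (simp add: Hewitt_extension_def)

lemma G_delta_open: "G_delta X A \<Longrightarrow> is_open X (elems A)"
  using P_space_X by (auto simp: P_space_def is_open_elems)

text \<open>Disjoint neighbourhoods of two different values would be pulled back to an open set that meets the
  image of \<open>h\<close>.\<close>

lemma agree_if_agree_on_dense:
  assumes "f \<in> cmaps Y Z" "g \<in> cmaps Y Z" "Hausdorff Z" "y \<in> U" "is_open Y U"
    and "\<And>x. x \<in> elems (pts X) \<Longrightarrow> app h x \<in> U \<Longrightarrow> app f (app h x) = app g (app h x)"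
  shows "app f y = app g y"
proof (rule ccontr)
  assume neq: "app f y \<noteq> app g y"
  have y: "y \<in> elems (pts Y)" using is_open_subset[OF top_Y assms(5)] assms(4) by blast
  then obtain A B where AB: "is_open Z A" "is_open Z B" "app f y \<in> A" "app g y \<in> B" "A \<inter> B = {}"
    using assms(3) neq cmaps_app[OF assms(1)] cmaps_app[OF assms(2)] unfolding Hausdorff_def by metis
  have "is_open Y (U \<inter> ({y\<in>elems (pts Y). app f y \<in> A} \<inter> {y\<in>elems (pts Y). app g y \<in> B}))"
    by (intro is_open_Int top_Y assms(5) cmaps_vimage[OF assms(1) AB(1)] cmaps_vimage[OF assms(2) AB(2)])
  then obtain x where "x \<in> elems (pts X)" "app h x \<in> U" "app f (app h x) \<in> A" "app g (app h x) \<in> B"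
    by (rule dense[of _ y]) (use y AB assms(4) in auto)
  then show False using assms(6) AB(5) by auto
qed

text \<open>The transfer principle. The discrete reals are a closed set \<open>S\<close> in \<open>E\<^sup>J\<close>, so \<open>k\<close> becomes a map \<open>\<kappa>\<close>
  into \<open>E\<^sup>J\<close>. Its coordinates have open fibres too, hence are continuous and extend to \<open>Y\<close>; their values
  at \<open>p\<close> form a point \<open>q\<close> of \<open>E\<^sup>J\<close>. Every neighbourhood of \<open>q\<close> contains \<open>\<kappa> x\<close> for all \<open>x\<close> near \<open>p\<close>.
  Therefore \<open>q \<in> S\<close>, and as \<open>q\<close> is isolated in \<open>S\<close>, \<open>\<kappa>\<close> is constantly \<open>q\<close> near \<open>p\<close>.\<close>

lemma locally_constant:
  assumes k: "k \<in> funs (pts X) (fcarrier \<R>)"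
    and fibres: "\<And>r. r \<in> C \<Longrightarrow> is_open X {x\<in>elems (pts X). app k x = r}"
    and p: "p \<in> elems (pts Y)"
  obtains r U where "r \<in> C" "is_open Y U" "p \<in> U"
    "\<And>x. x \<in> elems (pts X) \<Longrightarrow> app h x \<in> U \<Longrightarrow> app k x = r"
proof -
  obtain J S e where S: "closed_in (power_space E J) S"
    and e: "homeomorphism e (discrete (fcarrier \<R>)) (subspace (power_space E J) S)"
    using E_compact_reals unfolding E_compact_def by blast
  obtain e' where e_funs: "e \<in> funs (fcarrier \<R>) S" and
    e': "e' \<in> cmaps (subspace (power_space E J) S) (discrete (fcarrier \<R>))"
    "\<And>r. r \<in> C \<Longrightarrow> app e' (app e r) = r" "\<And>s. s \<in> elems S \<Longrightarrow> app e (app e' s) = s"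
    using e unfolding homeomorphism_def by (auto dest: cmaps_funs)
  have S_sub: "elems S \<subseteq> funs J (pts E)" using S by (auto simp: closed_in_iff)
  obtain \<kappa> where \<kappa>: "\<kappa> \<in> funs (pts X) S" "\<And>x. x \<in> elems (pts X) \<Longrightarrow> app \<kappa> x = app e (app k x)"
    using composition_exists[OF k e_funs] by blast
  have \<kappa>_S: "app \<kappa> x \<in> elems S" if "x \<in> elems (pts X)" for x using app_in[OF \<kappa>(1) that] .
  note h_mem = opair_mem_fun[OF h_funs] and \<kappa>_mem = opair_mem_fun[OF \<kappa>(1)]
  have coord: "opair j u \<in> elems s \<longleftrightarrow> u = app s j" if "j \<in> elems J" "s \<in> elems S" for j u s
    using opair_mem_fun[of s J "pts E"] S_sub that by blast
  have ext: "\<exists>g\<in>cmaps Y E. \<forall>x\<in>elems (pts X). app g (app h x) = app (app \<kappa> x) j" if j: "j \<in> elems J" for j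
  proof -
    obtain f where f: "f \<in> funs (pts X) (pts E)"
      "\<And>x. x \<in> elems (pts X) \<Longrightarrow> \<exists>s. opair x s \<in> elems \<kappa> \<and> opair j (app f x) \<in> elems s"
    proof (rule function_exists[of "\<lambda>x y. \<exists>s. opair x s \<in> elems \<kappa> \<and> opair j y \<in> elems s"])
      show "definable (\<lambda>e. \<exists>s. opair (e 0) s \<in> elems \<kappa> \<and> opair j (e 1) \<in> elems s)"
        by (intro definable_intros)
      show "\<exists>y. y \<in> elems (pts E) \<and> (\<exists>s. opair x s \<in> elems \<kappa> \<and> opair j y \<in> elems s)"
        if x: "x \<in> elems (pts X)" for x
        using \<kappa>_S[OF x] S_sub app_in[OF _ j] coord[OF j \<kappa>_S[OF x]] x by (auto simp: \<kappa>_mem)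
    qed (use coord[OF j \<kappa>_S] in \<open>auto simp: \<kappa>_mem\<close>)
    have f_eq: "app f x = app (app \<kappa> x) j" if "x \<in> elems (pts X)" for x
      using f(2)[OF that] coord[OF j \<kappa>_S] that by (auto simp: \<kappa>_mem)
    have "f \<in> cmaps X E"
      unfolding cmaps_iff
    proof (intro conjI allI impI f(1))
      fix V assume "is_open E V"
      then have "is_set {x\<in>elems (pts X). app f x \<in> V}"
        using is_set_vimage[OF f(1)] is_open_is_set by blast
      then show "is_open X {x\<in>elems (pts X). app f x \<in> V}"
      proof (rule is_openI[OF top_X])
        fix x assume x: "x \<in> {x\<in>elems (pts X). app f x \<in> V}"
        then have "is_open X {z\<in>elems (pts X). app k z = app k x}"
          using fibres app_in[OF k] by blast
        then show "\<exists>U. is_open X U \<and> x \<in> U \<and> U \<subseteq> {x\<in>elems (pts X). app f x \<in> V}"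
          using x f_eq \<kappa>(2) by (intro exI[of _ "{z\<in>elems (pts X). app k z = app k x}"]) auto
      qed
    qed
    then show ?thesis using extend f_eq by fastforce
  qed
  obtain G where G: "elems G = cmaps Y E" using is_set_cmaps[of Y E] by (auto simp: is_set_def)
  \<comment> \<open>Membership of pairs takes the place of application, because \<open>app\<close> is not given by a formula; the fact
  \<open>\<psi>\<close> translates.\<close>
  let ?\<psi> = "\<lambda>j v. \<exists>g\<in>elems G. (\<forall>x\<in>elems (pts X). \<forall>y. opair x y \<in> elems h \<longrightarrow>
      (\<forall>s. opair x s \<in> elems \<kappa> \<longrightarrow> (\<forall>u. opair j u \<in> elems s \<longrightarrow> opair y u \<in> elems g))) \<and> opair p v \<in> elems g"
  have \<psi>: "?\<psi> j v \<longleftrightarrow> (\<exists>g\<in>cmaps Y E. (\<forall>x\<in>elems (pts X). app g (app h x) = app (app \<kappa> x) j) \<and> v = app g p)"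
    if j: "j \<in> elems J" for j v
  proof -
    have "(\<forall>x\<in>elems (pts X). \<forall>y. opair x y \<in> elems h \<longrightarrow>
      (\<forall>s. opair x s \<in> elems \<kappa> \<longrightarrow> (\<forall>u. opair j u \<in> elems s \<longrightarrow> opair y u \<in> elems g))) \<and> opair p v \<in> elems g
      \<longleftrightarrow> (\<forall>x\<in>elems (pts X). app g (app h x) = app (app \<kappa> x) j) \<and> v = app g p" if "g \<in> cmaps Y E" for g
      using p coord[OF j \<kappa>_S] by (auto simp: h_mem \<kappa>_mem opair_mem_fun[OF cmaps_funs[OF that]])
    then show ?thesis unfolding G by blast
  qed
  \<comment> \<open>The coordinate of \<open>q\<close> at \<open>j\<close> is the value at \<open>p\<close> of an extension of the \<open>j\<close>-th coordinate of \<open>\<kappa>\<close>.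
  Extensions are not chosen: as \<open>E\<close> is Hausdorff, all of them agree at \<open>p\<close>.\<close>
  obtain q where q: "q \<in> funs J (pts E)" "\<And>j. j \<in> elems J \<Longrightarrow> ?\<psi> j (app q j)"
  proof (rule function_exists[of ?\<psi> J "pts E"])
    show "definable (\<lambda>e. ?\<psi> (e 0) (e 1))" by (intro definable_intros)
    show "\<exists>v. v \<in> elems (pts E) \<and> ?\<psi> j v" if j: "j \<in> elems J" for j
      unfolding \<psi>[OF j] using ext[OF j] cmaps_app p by blast
    show "v = w" if j: "j \<in> elems J" and vw: "?\<psi> j v" "?\<psi> j w" for j v w
    proof -
      obtain g g' where g: "g \<in> cmaps Y E" "\<forall>x\<in>elems (pts X). app g (app h x) = app (app \<kappa> x) j" "v = app g p"
        and g': "g' \<in> cmaps Y E" "\<forall>x\<in>elems (pts X). app g' (app h x) = app (app \<kappa> x) j" "w = app g' p"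
        using vw unfolding \<psi>[OF j] by blast
      then show "v = w"
        using agree_if_agree_on_dense[OF g(1) g'(1) Tychonoff_Hausdorff[OF Tychonoff_E] p is_open_pts[OF top_Y]] by simp
    qed
  qed (rule that)
  \<comment> \<open>The sets \<open>W\<close> with \<open>?Q W\<close> form a topology on \<open>E\<^sup>J\<close> that contains the subbasic sets.\<close>
  let ?Q = "\<lambda>W. q \<in> W \<longrightarrow> (\<exists>U\<in>elems (opens Y). p \<in> elems U \<and>
      (\<forall>x\<in>elems (pts X). \<forall>y\<in>elems U. opair x y \<in> elems h \<longrightarrow> (\<exists>w\<in>W. opair x w \<in> elems \<kappa>)))"
  have Q: "?Q W \<longleftrightarrow> (q \<in> W \<longrightarrow> (\<exists>U. is_open Y U \<and> p \<in> U \<and> (\<forall>x\<in>elems (pts X). app h x \<in> U \<longrightarrow> app \<kappa> x \<in> W)))" for W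
  proof -
    have "(\<forall>x\<in>elems (pts X). \<forall>y\<in>elems U. opair x y \<in> elems h \<longrightarrow> (\<exists>w\<in>W. opair x w \<in> elems \<kappa>)) \<longleftrightarrow>
        (\<forall>x\<in>elems (pts X). app h x \<in> elems U \<longrightarrow> app \<kappa> x \<in> W)" for U
      by (auto simp: h_mem \<kappa>_mem)
    then show ?thesis by (auto simp: is_open_def)
  qed
  have near: "\<exists>U. is_open Y U \<and> p \<in> U \<and> (\<forall>x\<in>elems (pts X). app h x \<in> U \<longrightarrow> app \<kappa> x \<in> W)"
    if W: "is_open (power_space E J) W" and qW: "q \<in> W" for W
  proof -
    have "?Q W"
      using W
    proof (induction W rule: power_space_open_induct)
      case definable
      show ?case by (intro definable_intros)
    next
      case whole
      show ?case unfolding Q using \<kappa>_S S_sub is_open_pts[OF top_Y] p by blast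
    next
      case (Int U V)
      then show ?case unfolding Q using is_open_Int[OF top_Y] by (metis IntD1 IntD2 IntI)
    next
      case (Union S)
      show ?case
        unfolding Q
      proof
        assume "q \<in> (\<Union>U\<in>elems S. elems U)"
        then obtain U V where "U \<in> elems S" "is_open Y V" "p \<in> V"
          "\<forall>x\<in>elems (pts X). app h x \<in> V \<longrightarrow> app \<kappa> x \<in> elems U"
          using Union unfolding Q by blast
        then show "\<exists>V. is_open Y V \<and> p \<in> V \<and>
            (\<forall>x\<in>elems (pts X). app h x \<in> V \<longrightarrow> app \<kappa> x \<in> (\<Union>U\<in>elems S. elems U))" by blast
      qed
    next
      case (projection j U)
      obtain g where g: "g \<in> cmaps Y E" "\<forall>x\<in>elems (pts X). app g (app h x) = app (app \<kappa> x) j" "app q j = app g p"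
        using q(2)[OF projection(1)] unfolding \<psi>[OF projection(1)] by blast
      have "is_open Y {y\<in>elems (pts Y). app g y \<in> U}" using cmaps_vimage g(1) projection(2) by blast
      moreover have "app \<kappa> x \<in> funs J (pts E)" if "x \<in> elems (pts X)" for x using that \<kappa>_S S_sub by blast
      ultimately show ?case
        unfolding Q using g(2,3) p by (intro impI exI[of _ "{y\<in>elems (pts Y). app g y \<in> U}"]) auto
    qed simp
    then show ?thesis using qW unfolding Q by blast
  qed
  have "q \<in> elems S"
  proof (rule ccontr)
    assume "q \<notin> elems S"
    then obtain U where "is_open Y U" "p \<in> U" "\<forall>x\<in>elems (pts X). app h x \<in> U \<longrightarrow> app \<kappa> x \<in> funs J (pts E) - elems S"
      using near[of "funs J (pts E) - elems S"] S q(1) by (auto simp: closed_in_iff)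
    then show False using dense \<kappa>_S by (metis DiffD2)
  qed
  define r where "r = app e' q"
  have r: "r \<in> C" using cmaps_app[OF e'(1)] \<open>q \<in> elems S\<close> by (simp add: r_def)
  have "is_open (discrete (fcarrier \<R>)) {r}" using r is_set_singleton by (simp add: is_open_discrete)
  from cmaps_vimage[OF e'(1) this] obtain W where W: "is_open (power_space E J) W"
    "{s\<in>elems S. app e' s \<in> {r}} = W \<inter> elems S" by (auto simp: is_open_subspace)
  then have "q \<in> W" using \<open>q \<in> elems S\<close> by (auto simp: r_def)
  then obtain U where U: "is_open Y U" "p \<in> U" "\<forall>x\<in>elems (pts X). app h x \<in> U \<longrightarrow> app \<kappa> x \<in> W"
    using near W(1) by blast
  have "app k x = r" if "x \<in> elems (pts X)" "app h x \<in> U" for x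
  proof -
    have "app \<kappa> x \<in> W \<inter> elems S" using that U(3) \<kappa>_S by blast
    then have "app e' (app \<kappa> x) = r" using W(2) by blast
    then show ?thesis using \<kappa>(2) e'(2) app_in[OF k] that by simp
  qed
  then show thesis using that r U by blast
qed

text \<open>On \<open>X\<close> the function has open fibres, because a preimage of a point is a \<open>G\<^sub>\<delta>\<close>. So it is constant
  on the trace of some neighbourhood of each point of \<open>Y\<close>, and by density on the whole neighbourhood.\<close>

lemma clopen_fibre:
  assumes f: "f \<in> cmaps Y (real_line \<R>)" and c: "c \<in> C"
  shows "clopen Y {y\<in>elems (pts Y). app f y = c}"
proof -
  have fC: "app f y \<in> C" if "y \<in> elems (pts Y)" for y using cmaps_app[OF f that] by simp
  have f_funs: "f \<in> funs (pts Y) (fcarrier \<R>)" using cmaps_funs[OF f] by simp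
  obtain k where k: "k \<in> funs (pts X) (fcarrier \<R>)" "\<And>x. x \<in> elems (pts X) \<Longrightarrow> app k x = app f (app h x)"
    using composition_exists[OF h_funs f_funs] by blast
  have "k \<in> cmaps X (real_line \<R>)"
    unfolding cmaps_iff pts_real_line
  proof (intro conjI allI impI k(1))
    fix V assume "is_open (real_line \<R>) V"
    from cmaps_vimage[OF h_cmaps cmaps_vimage[OF f this]]
    show "is_open X {x\<in>elems (pts X). app k x \<in> V}" using k(2) by (simp cong: conj_cong)
  qed
  have fibres: "is_open X {x\<in>elems (pts X). app k x = r}" if r: "r \<in> C" for r
  proof -
    have "is_set {x\<in>elems (pts X). app k x \<in> {r}}" using is_set_vimage[OF k(1) is_set_singleton] .
    then obtain A where A: "elems A = {x\<in>elems (pts X). app k x = r}" by (auto simp: is_set_def)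
    then have "G_delta X A"
      using G_delta_vimage[OF \<open>k \<in> cmaps X (real_line \<R>)\<close> G_delta_real_singleton[OF r]] by simp
    then show ?thesis using G_delta_open A by metis
  qed
  have loc: "\<exists>U. is_open Y U \<and> y \<in> U \<and> (\<forall>z\<in>U. app f z = app f y)" if y: "y \<in> elems (pts Y)" for y
  proof -
    obtain r U where U: "r \<in> C" "is_open Y U" "y \<in> U"
      "\<And>x. x \<in> elems (pts X) \<Longrightarrow> app h x \<in> U \<Longrightarrow> app k x = r"
      using locally_constant[OF k(1) fibres y] by blast
    have "app f z = r" if z: "z \<in> U" for z
    proof (rule ccontr)
      assume "app f z \<noteq> r"
      moreover have zY: "z \<in> elems (pts Y)" using is_open_subset[OF top_Y U(2)] z by blast
      ultimately obtain A B where AB: "is_open (real_line \<R>) A" "app f z \<in> A" "r \<in> B" "A \<inter> B = {}"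
        using real_line_Hausdorff[OF fC U(1)] by metis
      have "is_open Y (U \<inter> {y\<in>elems (pts Y). app f y \<in> A})"
        using is_open_Int[OF top_Y U(2) cmaps_vimage[OF f AB(1)]] .
      then obtain x where "x \<in> elems (pts X)" "app h x \<in> U" "app f (app h x) \<in> A"
        by (rule dense[of _ z]) (use z zY AB in auto)
      then show False using U(4) k(2) AB by auto
    qed
    then show ?thesis using U by metis
  qed
  have 1: "is_set {y\<in>elems (pts Y). app f y = c}"
    using is_set_vimage[OF f_funs is_set_singleton[of c]] by simp
  then obtain A where A: "elems A = {y\<in>elems (pts Y). app f y = c}" by (auto simp: is_set_def)
  have 2: "is_set (elems (pts Y) - {y\<in>elems (pts Y). app f y = c})"
    using elems_Diff[of "pts Y" A] unfolding A is_set_def by blast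
  show ?thesis
    unfolding clopen_def
  proof (intro conjI)
    show "is_open Y {y\<in>elems (pts Y). app f y = c}"
    proof (rule is_openI[OF top_Y 1])
      fix y assume y: "y \<in> {y\<in>elems (pts Y). app f y = c}"
      then obtain U where U: "is_open Y U" "y \<in> U" "\<forall>z\<in>U. app f z = app f y" using loc by blast
      have "z \<in> {y\<in>elems (pts Y). app f y = c}" if "z \<in> U" for z
        using bspec[OF U(3) that] subsetD[OF is_open_subset[OF top_Y U(1)] that] y by simp
      then show "\<exists>U. is_open Y U \<and> y \<in> U \<and> U \<subseteq> {y\<in>elems (pts Y). app f y = c}"
        using U by blast
    qed
    show "is_open Y (elems (pts Y) - {y\<in>elems (pts Y). app f y = c})"
    proof (rule is_openI[OF top_Y 2])
      fix y assume y: "y \<in> elems (pts Y) - {y\<in>elems (pts Y). app f y = c}"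
      then obtain U where U: "is_open Y U" "y \<in> U" "\<forall>z\<in>U. app f z = app f y" using loc by blast
      have "z \<in> elems (pts Y) - {y\<in>elems (pts Y). app f y = c}" if "z \<in> U" for z
        using bspec[OF U(3) that] subsetD[OF is_open_subset[OF top_Y U(1)] that] y by simp
      then show "\<exists>U. is_open Y U \<and> y \<in> U \<and> U \<subseteq> elems (pts Y) - {y\<in>elems (pts Y). app f y = c}"
        using U by blast
    qed
  qed
qed

text \<open>The sets of \<open>E\<^sup>J\<close> that contain a clopen neighbourhood of each of their points in \<open>Y\<close> form a topology.
  It contains the subbasic sets: inside an open set of \<open>E\<close>, a point has a cozero neighbourhood, and on
  \<open>Y\<close> the corresponding real function has clopen fibres. Hence it contains all open sets of \<open>E\<^sup>J\<close>.\<close>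

lemma clopen_base:
  assumes G: "is_open Y G" and p: "p \<in> G"
  obtains V where "clopen Y V" "p \<in> V" "V \<subseteq> G"
proof -
  obtain J S e where S: "closed_in (power_space E J) S"
    and e: "homeomorphism e Y (subspace (power_space E J) S)"
    using Hewitt unfolding Hewitt_extension_def E_compact_def by blast
  obtain e' where e_cmaps: "e \<in> cmaps Y (subspace (power_space E J) S)" and
    e': "e' \<in> cmaps (subspace (power_space E J) S) Y"
    "\<And>y. y \<in> elems (pts Y) \<Longrightarrow> app e' (app e y) = y"
    using e unfolding homeomorphism_def by auto
  have e_funs: "e \<in> funs (pts Y) S" using cmaps_funs[OF e_cmaps] by simp
  have S_sub: "elems S \<subseteq> funs J (pts E)" using S by (auto simp: closed_in_iff)
  have e_S: "app e y \<in> elems S" if "y \<in> elems (pts Y)" for y using app_in[OF e_funs that] .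
  note e_mem = opair_mem_fun[OF e_funs]
  \<comment> \<open>Stated with membership instead of application and \<open>clopen\<close>, so that it is visibly definable.\<close>
  let ?Q = "\<lambda>W. \<forall>y\<in>elems (pts Y). (\<exists>w\<in>W. opair y w \<in> elems e) \<longrightarrow>
      (\<exists>V. (V \<in> elems (opens Y) \<and>
        (\<exists>W\<in>elems (opens Y). \<forall>z. z \<in> elems W \<longleftrightarrow> z \<in> elems (pts Y) \<and> z \<notin> elems V)) \<and>
        y \<in> elems V \<and> (\<forall>v\<in>elems V. \<exists>w\<in>W. opair v w \<in> elems e))"
  have Q: "?Q W \<longleftrightarrow> (\<forall>y\<in>elems (pts Y). app e y \<in> W \<longrightarrow>
      (\<exists>V. clopen Y V \<and> y \<in> V \<and> (\<forall>v\<in>V. app e v \<in> W)))" for W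
  proof -
    have 1: "clopen Y (elems V) \<and> y \<in> elems V \<and> (\<forall>v\<in>elems V. \<exists>w\<in>W. opair v w \<in> elems e) \<longleftrightarrow>
        clopen Y (elems V) \<and> y \<in> elems V \<and> (\<forall>v\<in>elems V. app e v \<in> W)" for V y
      using is_open_subset[OF top_Y, of "elems V"] by (auto simp: e_mem clopen_def)
    have 2: "(\<exists>w\<in>W. opair y w \<in> elems e) \<longleftrightarrow> y \<in> elems (pts Y) \<and> app e y \<in> W" for y
      by (auto simp: e_mem)
    have 3: "(\<exists>V. clopen Y V \<and> y \<in> V \<and> (\<forall>v\<in>V. app e v \<in> W)) \<longleftrightarrow>
        (\<exists>V. clopen Y (elems V) \<and> y \<in> elems V \<and> (\<forall>v\<in>elems V. app e v \<in> W))" for y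
      by (auto simp: clopen_def is_open_def)
    show ?thesis
      unfolding clopen_elems_iff[symmetric] unfolding 1 unfolding 2 3 by blast
  qed
  have near: "\<exists>V. clopen Y V \<and> y \<in> V \<and> (\<forall>v\<in>V. app e v \<in> W)"
    if W: "is_open (power_space E J) W" and y: "y \<in> elems (pts Y)" "app e y \<in> W" for W y
  proof -
    have "?Q W"
      using W
    proof (induction W rule: power_space_open_induct)
      case definable
      show ?case by (intro definable_intros)
    next
      case whole
      have "clopen Y (elems (pts Y))"
        using is_open_pts[OF top_Y] is_open_empty[OF top_Y] by (simp add: clopen_def)
      then show ?case unfolding Q using e_S S_sub by blast
    next
      case (Int U V)
      then show ?case unfolding Q using clopen_Int[OF top_Y] by (metis IntD1 IntD2 IntI)
    next
      case (Union S)
      show ?case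
        unfolding Q
      proof (intro ballI impI)
        fix y assume "y \<in> elems (pts Y)" "app e y \<in> (\<Union>U\<in>elems S. elems U)"
        then obtain U V where "U \<in> elems S" "clopen Y V" "y \<in> V" "\<forall>v\<in>V. app e v \<in> elems U"
          using Union unfolding Q by blast
        then show "\<exists>V. clopen Y V \<and> y \<in> V \<and> (\<forall>v\<in>V. app e v \<in> (\<Union>U\<in>elems S. elems U))" by blast
      qed
    next
      case (projection j U)
      show ?case
        unfolding Q
      proof (intro ballI impI)
        fix y assume y: "y \<in> elems (pts Y)" "app e y \<in> {f\<in>funs J (pts E). app f j \<in> U}"
        obtain \<phi> where \<phi>: "\<phi> \<in> cmaps E (real_line \<R>)" "app \<phi> (app (app e y) j) \<noteq> \<^bold>0"
          "\<And>u. u \<in> elems (pts E) \<Longrightarrow> app \<phi> u \<noteq> \<^bold>0 \<Longrightarrow> u \<in> U"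
          using Tychonoff_separation[OF Tychonoff_E projection(2), of "app (app e y) j"] y(2) by blast
        have coord: "opair j u \<in> elems (app e z) \<longleftrightarrow> u = app (app e z) j" "app (app e z) j \<in> elems (pts E)"
          if "z \<in> elems (pts Y)" for z u
          using opair_mem_fun[of "app e z" J "pts E"] app_in[of "app e z" J "pts E" j] e_S[OF that] S_sub projection(1)
          by blast+
        obtain \<pi> where \<pi>: "\<pi> \<in> funs (pts Y) (pts E)"
          "\<And>z. z \<in> elems (pts Y) \<Longrightarrow> \<exists>s. opair z s \<in> elems e \<and> opair j (app \<pi> z) \<in> elems s"
        proof (rule function_exists[of "\<lambda>z u. \<exists>s. opair z s \<in> elems e \<and> opair j u \<in> elems s"])
          show "definable (\<lambda>n. \<exists>s. opair (n 0) s \<in> elems e \<and> opair j (n 1) \<in> elems s)"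
            by (intro definable_intros)
        qed (use coord in \<open>auto simp: e_mem\<close>)
        have \<pi>_eq: "app \<pi> z = app (app e z) j" if "z \<in> elems (pts Y)" for z
          using \<pi>(2)[OF that] coord[OF that] by (auto simp: e_mem)
        obtain f where f: "f \<in> funs (pts Y) (fcarrier \<R>)" "\<And>z. z \<in> elems (pts Y) \<Longrightarrow> app f z = app \<phi> (app \<pi> z)"
          using composition_exists[OF \<pi>(1)] cmaps_funs[OF \<phi>(1)] by (metis pts_real_line)
        have "f \<in> cmaps Y (real_line \<R>)"
          unfolding cmaps_iff pts_real_line
        proof (intro conjI allI impI f(1))
          fix V assume "is_open (real_line \<R>) V"
          then have "is_open E {u\<in>elems (pts E). app \<phi> u \<in> V}" using cmaps_vimage[OF \<phi>(1)] by blast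
          then have "is_open (power_space E J) {g\<in>funs J (pts E). app g j \<in> {u\<in>elems (pts E). app \<phi> u \<in> V}}"
            using is_open_projection projection(1) by blast
          then have "is_open (subspace (power_space E J) S)
              ({g\<in>funs J (pts E). app g j \<in> {u\<in>elems (pts E). app \<phi> u \<in> V}} \<inter> elems S)"
            unfolding is_open_subspace by blast
          from cmaps_vimage[OF e_cmaps this]
          have "is_open Y {z\<in>elems (pts Y). app e z \<in>
              {g\<in>funs J (pts E). app g j \<in> {u\<in>elems (pts E). app \<phi> u \<in> V}} \<inter> elems S}" .
          moreover have "{z\<in>elems (pts Y). app e z \<in>
              {g\<in>funs J (pts E). app g j \<in> {u\<in>elems (pts E). app \<phi> u \<in> V}} \<inter> elems S} =
              {z\<in>elems (pts Y). app f z \<in> V}"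
            using e_S S_sub coord(2) f(2) \<pi>_eq by auto
          ultimately show "is_open Y {z\<in>elems (pts Y). app f z \<in> V}" by simp
        qed
        moreover have "app f y \<in> C" using app_in[OF f(1) y(1)] .
        ultimately have "clopen Y {z\<in>elems (pts Y). app f z = app f y}" by (rule clopen_fibre)
        moreover have "app e z \<in> {f\<in>funs J (pts E). app f j \<in> U}"
          if "z \<in> elems (pts Y)" "app f z = app f y" for z
          using that \<phi>(2,3) f(2) \<pi>_eq y coord(2) e_S S_sub by auto
        ultimately show "\<exists>V. clopen Y V \<and> y \<in> V \<and> (\<forall>v\<in>V. app e v \<in> {f\<in>funs J (pts E). app f j \<in> U})"
          using y(1) by (intro exI[of _ "{z\<in>elems (pts Y). app f z = app f y}"]) blast
      qed
    qed simp
    then show ?thesis using y unfolding Q by blast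
  qed
  from cmaps_vimage[OF e'(1) G] obtain W where W: "is_open (power_space E J) W"
    "{s\<in>elems S. app e' s \<in> G} = W \<inter> elems S" by (auto simp: is_open_subspace)
  have GY: "G \<subseteq> elems (pts Y)" using is_open_subset[OF top_Y G] .
  then have "app e p \<in> {s\<in>elems S. app e' s \<in> G}" using e_S e'(2) p by auto
  then have "app e p \<in> W" using W(2) by blast
  then obtain V where V: "clopen Y V" "p \<in> V" "\<forall>v\<in>V. app e v \<in> W" using near[OF W(1)] p GY by blast
  have "v \<in> G" if "v \<in> V" for v
  proof -
    have vY: "v \<in> elems (pts Y)" using that V(1) is_open_subset[OF top_Y] unfolding clopen_def by blast
    then have "app e v \<in> {s\<in>elems S. app e' s \<in> G}" unfolding W(2) using V(3) e_S that by blast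
    then show ?thesis using e'(2) vY by simp
  qed
  then show thesis using that V by blast
qed

text \<open>This is where \<open>CMC\<close> enters. It is enough to have finitely many candidates for each \<open>n\<close>, because the
  intersection of all of them is a candidate again, and a canonical one.\<close>

lemma clopen_selection:
  assumes CMC and g: "g \<in> funs omega (opens Y)"
    and p: "\<And>n. n \<in> elems omega \<Longrightarrow> p \<in> elems (app g n)"
  obtains V where "V \<in> funs omega (opens Y)"
    "\<And>n. n \<in> elems omega \<Longrightarrow> clopen Y (elems (app V n))"
    "\<And>n. n \<in> elems omega \<Longrightarrow> p \<in> elems (app V n)"
    "\<And>n. n \<in> elems omega \<Longrightarrow> elems (app V n) \<subseteq> elems (app g n)"
proof -
  let ?\<phi> = "\<lambda>n V. (V \<in> elems (opens Y) \<and>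
      (\<exists>W\<in>elems (opens Y). \<forall>z. z \<in> elems W \<longleftrightarrow> z \<in> elems (pts Y) \<and> z \<notin> elems V)) \<and>
      p \<in> elems V \<and> (\<forall>G. opair n G \<in> elems g \<longrightarrow> elems V \<subseteq> elems G)"
  have \<phi>: "?\<phi> n V \<longleftrightarrow> clopen Y (elems V) \<and> p \<in> elems V \<and> elems V \<subseteq> elems (app g n)"
    if "n \<in> elems omega" for n V
    using that unfolding clopen_elems_iff[symmetric] by (simp add: opair_mem_fun[OF g])
  obtain A where A: "A \<in> funs omega (pow (opens Y))"
    "\<And>n. n \<in> elems omega \<Longrightarrow> \<forall>V. V \<in> elems (app A n) \<longleftrightarrow> ?\<phi> n V"
  proof (rule function_exists[of "\<lambda>n a. \<forall>V. V \<in> elems a \<longleftrightarrow> ?\<phi> n V" omega "pow (opens Y)"])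
    show "definable (\<lambda>e. \<forall>V. V \<in> elems (e 1) \<longleftrightarrow> ?\<phi> (e 0) V)" by (intro definable_intros)
    show "\<exists>a. a \<in> elems (pow (opens Y)) \<and> (\<forall>V. V \<in> elems a \<longleftrightarrow> ?\<phi> n V)" for n
    proof -
      have "definable (\<lambda>e. ?\<phi> n (e 0))" by (intro definable_intros)
      then have "is_set {V. ?\<phi> n V}" by (rule is_set_subset[of _ "opens Y"]) blast
      then obtain a where a: "elems a = {V. ?\<phi> n V}" unfolding is_set_def by blast
      show ?thesis
      proof (intro exI[of _ a] conjI)
        show "a \<in> elems (pow (opens Y))" using a by auto
        show "\<forall>V. V \<in> elems a \<longleftrightarrow> ?\<phi> n V" unfolding a by blast
      qed
    qed
    show "a = b" if "\<forall>V. V \<in> elems a \<longleftrightarrow> ?\<phi> n V" "\<forall>V. V \<in> elems b \<longleftrightarrow> ?\<phi> n V" for n a b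
    proof -
      have "V \<in> elems a \<longleftrightarrow> V \<in> elems b" for V by (simp only: that[THEN spec])
      then show ?thesis by (intro extensionality) blast
    qed
  qed (rule that)
  have A_iff: "V \<in> elems (app A n) \<longleftrightarrow> clopen Y (elems V) \<and> p \<in> elems V \<and> elems V \<subseteq> elems (app g n)"
    if "n \<in> elems omega" for n V
    using A(2)[OF that, THEN spec, of V] unfolding \<phi>[OF that] .
  have "elems (app A n) \<noteq> {}" if n: "n \<in> elems omega" for n
  proof -
    have "is_open Y (elems (app g n))" using app_in[OF g n] by (simp add: is_open_elems)
    then obtain V where V: "clopen Y V" "p \<in> V" "V \<subseteq> elems (app g n)"
      by (rule clopen_base[OF _ p[OF n]])
    then obtain v where "elems v = V" unfolding clopen_def is_open_def by blast
    then have "v \<in> elems (app A n)" using A_iff[OF n] V by simp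
    then show ?thesis by blast
  qed
  then obtain D F where F: "F \<in> funs omega D" "\<And>n. n \<in> elems omega \<Longrightarrow>
      elems (app F n) \<subseteq> elems (app A n) \<and> elems (app F n) \<noteq> {} \<and> is_finite (app F n)"
    using \<open>CMC\<close> A(1) unfolding CMC_def by metis
  let ?I = "\<lambda>n. {y\<in>elems (pts Y). \<forall>V\<in>elems (app F n). y \<in> elems V}"
  have FV: "clopen Y (elems V)" "p \<in> elems V" "elems V \<subseteq> elems (app g n)"
    if "n \<in> elems omega" "V \<in> elems (app F n)" for n V
    using F(2)[OF that(1)] that(2) A_iff[OF that(1), of V] by auto
  have I_open: "is_open Y (?I n)" if n: "n \<in> elems omega" for n
  proof -
    obtain N f where N: "N \<in> elems omega" "f \<in> funs N (app F n)" "bij_betw (app f) (elems N) (elems (app F n))"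
      using F(2)[OF n] unfolding is_finite_def by blast
    have "elems (app F n) \<subseteq> elems (opens Y)"
      using FV(1)[OF n] by (auto simp: clopen_def is_open_elems)
    then have "f \<in> funs N (opens Y)" using N(2) funs_mono by blast
    then have "is_open Y {y\<in>elems (pts Y). \<forall>i\<in>elems N. y \<in> elems (app f i)}"
      using finite_Inter_open[OF top_Y _ N(1)] by blast
    moreover have "{y\<in>elems (pts Y). \<forall>i\<in>elems N. y \<in> elems (app f i)} = ?I n"
      by (simp flip: bij_betw_imp_surj_on[OF N(3)])
    ultimately show ?thesis by simp
  qed
  have I_clopen: "clopen Y (?I n)" if n: "n \<in> elems omega" for n
    unfolding clopen_def
  proof (intro conjI I_open[OF n] is_openI[OF top_Y])
    obtain u where "elems u = ?I n" using I_open[OF n] unfolding is_open_def by blast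
    then show "is_set (elems (pts Y) - ?I n)" by (metis elems_Diff is_set_elems)
    fix y assume "y \<in> elems (pts Y) - ?I n"
    then obtain V where V: "V \<in> elems (app F n)" "y \<in> elems (pts Y) - elems V" by blast
    then have "is_open Y (elems (pts Y) - elems V)" using FV(1)[OF n V(1)] by (simp add: clopen_def)
    then show "\<exists>U. is_open Y U \<and> y \<in> U \<and> U \<subseteq> elems (pts Y) - ?I n"
      using V by blast
  qed
  let ?\<psi> = "\<lambda>n U. \<forall>y. y \<in> elems U \<longleftrightarrow> y \<in> elems (pts Y) \<and> (\<forall>f. opair n f \<in> elems F \<longrightarrow> (\<forall>V\<in>elems f. y \<in> elems V))"
  have \<psi>: "?\<psi> n U \<longleftrightarrow> elems U = ?I n" if "n \<in> elems omega" for n U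
    using that by (auto simp: opair_mem_fun[OF F(1)])
  obtain V where V: "V \<in> funs omega (opens Y)" "\<And>n. n \<in> elems omega \<Longrightarrow> ?\<psi> n (app V n)"
  proof (rule function_exists[of ?\<psi> omega "opens Y"])
    show "definable (\<lambda>e. ?\<psi> (e 0) (e 1))" by (intro definable_intros)
    show "\<exists>U. U \<in> elems (opens Y) \<and> ?\<psi> n U" if "n \<in> elems omega" for n
      using I_open[OF that] unfolding \<psi>[OF that] is_open_def by blast
    show "a = b" if "n \<in> elems omega" "?\<psi> n a" "?\<psi> n b" for n a b
      using that(2,3) unfolding \<psi>[OF that(1)] by (intro extensionality) simp
  qed (rule that)
  have V_eq: "elems (app V n) = ?I n" if "n \<in> elems omega" for n
    using V(2)[OF that] unfolding \<psi>[OF that] .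
  show thesis
  proof (rule that[OF V(1)])
    fix n assume n: "n \<in> elems omega"
    show "clopen Y (elems (app V n))" using I_clopen[OF n] unfolding V_eq[OF n] .
    obtain v where v: "v \<in> elems (app F n)" using F(2)[OF n] by blast
    have "elems v \<subseteq> elems (pts Y)" using FV(1)[OF n v] is_open_subset[OF top_Y] unfolding clopen_def by blast
    then have "p \<in> elems (pts Y)" using FV(2)[OF n v] by blast
    then show "p \<in> elems (app V n)" unfolding V_eq[OF n] using FV(2)[OF n] by blast
    show "elems (app V n) \<subseteq> elems (app g n)" unfolding V_eq[OF n] using FV(3)[OF n v] v by blast
  qed
qed

text \<open>With clopen \<open>V n\<close> between \<open>p\<close> and \<open>g n\<close>, the function that records the first exit from \<open>V\<close> has open
  fibres on \<open>X\<close>. It is then constant on the trace of a neighbourhood \<open>U\<close> of \<open>p\<close>. The constant cannot be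
  the code of an exit at \<open>m\<close>, since \<open>U \<inter> V m\<close> meets \<open>X\<close>.\<close>

lemma G_delta_interior:
  assumes CMC and g: "g \<in> funs omega (opens Y)"
    and p: "\<And>n. n \<in> elems omega \<Longrightarrow> p \<in> elems (app g n)"
  obtains U where "is_open Y U" "p \<in> U" "\<And>n. n \<in> elems omega \<Longrightarrow> U \<subseteq> elems (app g n)"
proof -
  obtain V where V: "V \<in> funs omega (opens Y)"
    and V_clopen: "\<And>n. n \<in> elems omega \<Longrightarrow> clopen Y (elems (app V n))"
    and pV: "\<And>n. n \<in> elems omega \<Longrightarrow> p \<in> elems (app V n)"
    and Vg: "\<And>n. n \<in> elems omega \<Longrightarrow> elems (app V n) \<subseteq> elems (app g n)"
    using clopen_selection[OF assms] by blast
  have V_open: "is_open Y (elems (app V n))" if "n \<in> elems omega" for n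
    using V_clopen that by (simp add: clopen_def)
  have pY: "p \<in> elems (pts Y)" using is_open_subset[OF top_Y V_open[OF zero_in_omega]] pV by auto
  obtain s where s: "s \<in> funs omega (fcarrier \<R>)" "\<And>n. n \<in> elems omega \<Longrightarrow> \<^bold>0 \<prec> app s n"
    "\<And>m n. n \<in> elems omega \<Longrightarrow> m \<in> elems n \<Longrightarrow> app s n \<prec> app s m"
    using vanishing_sequence_exists by metis
  have s_irrefl: "\<not> app s n \<prec> app s n" if "n \<in> elems omega" for n
    using less_irrefl app_in[OF s(1) that] by blast
  have s_nonzero: "app s n \<noteq> \<^bold>0" if "n \<in> elems omega" for n
    using s(2)[OF that] less_irrefl[OF null_closed] by metis
  have s_inj: "app s n \<noteq> app s m" if "n \<in> elems omega" "m \<in> elems n" for m n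
    using s(3)[OF that] s_irrefl[OF that(1)] by metis
  obtain k where k: "k \<in> funs (pts Y) (fcarrier \<R>)"
    and k_exit: "\<And>y m. y \<in> elems (pts Y) \<Longrightarrow> m \<in> elems omega \<Longrightarrow> y \<notin> elems (app V m) \<Longrightarrow>
       (\<And>i. i \<in> elems m \<Longrightarrow> y \<in> elems (app V i)) \<Longrightarrow> app k y = app s m"
    and k_stay: "\<And>y. y \<in> elems (pts Y) \<Longrightarrow> (\<And>i. i \<in> elems omega \<Longrightarrow> y \<in> elems (app V i)) \<Longrightarrow> app k y = \<^bold>0"
    using first_exit_function[OF V s(1) s_inj] by blast
  note exit_or_stay = least_missing_index[OF V]
  obtain kX where kX: "kX \<in> funs (pts X) (fcarrier \<R>)" "\<And>x. x \<in> elems (pts X) \<Longrightarrow> app kX x = app k (app h x)"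
    using composition_exists[OF h_funs k] by blast
  have fibres: "is_open X {x\<in>elems (pts X). app kX x = r}" for r
  proof (rule is_openI[OF top_X])
    show "is_set {x\<in>elems (pts X). app kX x = r}"
      using is_set_vimage[OF kX(1) is_set_singleton[of r]] by simp
    fix x assume x: "x \<in> {x\<in>elems (pts X). app kX x = r}"
    from exit_or_stay[of "app h x"]
    show "\<exists>U. is_open X U \<and> x \<in> U \<and> U \<subseteq> {x\<in>elems (pts X). app kX x = r}"
    proof
      assume stay: "\<forall>i\<in>elems omega. app h x \<in> elems (app V i)"
      let ?\<phi> = "\<lambda>n x. \<exists>y U. opair x y \<in> elems h \<and> opair n U \<in> elems V \<and> y \<in> elems U"
      let ?A = "{x\<in>elems (pts X). \<forall>n\<in>elems omega. app h x \<in> elems (app V n)}"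
      have \<phi>: "?\<phi> n x \<longleftrightarrow> app h x \<in> elems (app V n)" if "n \<in> elems omega" "x \<in> elems (pts X)" for n x
        using that by (auto simp: opair_mem_fun[OF V] opair_mem_fun[OF h_funs])
      have "definable (\<lambda>e. \<forall>n\<in>elems omega. ?\<phi> n (e 0))" by (intro definable_intros)
      then have "is_set {x\<in>elems (pts X). \<forall>n\<in>elems omega. ?\<phi> n x}" by (rule is_set_Collect)
      then obtain A where A: "elems A = {x\<in>elems (pts X). \<forall>n\<in>elems omega. ?\<phi> n x}"
        unfolding is_set_def by blast
      have "G_delta X A"
      proof (rule G_deltaI[OF _ _ A])
        show "definable (\<lambda>e. ?\<phi> (e 1) (e 0))" by (intro definable_intros)
        show "is_open X {x\<in>elems (pts X). ?\<phi> n x}" if n: "n \<in> elems omega" for n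
          using cmaps_vimage[OF h_cmaps V_open[OF n]] \<phi>[OF n] by (simp cong: conj_cong)
      qed
      then have "is_open X (elems A)" by (rule G_delta_open)
      moreover have "elems A = ?A" unfolding A using \<phi> by blast
      ultimately have "is_open X ?A" by simp
      moreover have "x \<in> ?A" using x stay by blast
      moreover have "app kX z = \<^bold>0" if "z \<in> ?A" for z using that k_stay kX(2) by simp
      moreover have "r = \<^bold>0" using x stay k_stay[of "app h x"] kX(2)[of x] by auto
      ultimately show ?thesis by (intro exI[of _ ?A]) auto
    next
      assume "\<exists>m\<in>elems omega. app h x \<notin> elems (app V m) \<and> (\<forall>i\<in>elems m. app h x \<in> elems (app V i))"
      then obtain m where m: "m \<in> elems omega" "app h x \<notin> elems (app V m)" "\<forall>i\<in>elems m. app h x \<in> elems (app V i)"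
        by blast
      let ?B = "(elems (pts Y) - elems (app V m)) \<inter> {y\<in>elems (pts Y). \<forall>i\<in>elems m. y \<in> elems (app V i)}"
      have "is_open Y ?B"
        using is_open_Int[OF top_Y] V_clopen[OF m(1)] finite_Inter_open[OF top_Y V m(1) omega_subset[OF m(1)]]
        unfolding clopen_def by blast
      from cmaps_vimage[OF h_cmaps this] have "is_open X {x\<in>elems (pts X). app h x \<in> ?B}" .
      moreover have "x \<in> {x\<in>elems (pts X). app h x \<in> ?B}" using x m by simp
      moreover have "app kX z = app s m" if "z \<in> {x\<in>elems (pts X). app h x \<in> ?B}" for z
        using that k_exit[of "app h z" m] m(1) kX(2) by simp
      moreover have "r = app s m" using x m k_exit[of "app h x" m] kX(2)[of x] by auto
      ultimately show ?thesis by (intro exI[of _ "{x\<in>elems (pts X). app h x \<in> ?B}"]) auto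
    qed
  qed
  obtain r U where U: "is_open Y U" "p \<in> U"
    "\<And>x. x \<in> elems (pts X) \<Longrightarrow> app h x \<in> U \<Longrightarrow> app kX x = r"
    using locally_constant[OF kX(1) fibres pY] by blast
  have in_V: "app h x \<in> elems (app V n)" if x: "x \<in> elems (pts X)" "app h x \<in> U" and n: "n \<in> elems omega" for x n
  proof (rule ccontr)
    assume "app h x \<notin> elems (app V n)"
    then obtain m where m: "m \<in> elems omega" "app h x \<notin> elems (app V m)" "\<forall>i\<in>elems m. app h x \<in> elems (app V i)"
      using exit_or_stay n by blast
    then have r: "r = app s m" using U(3)[OF x] k_exit[of "app h x" m] kX(2) x(1) by simp
    have "is_open Y (U \<inter> elems (app V m))" using is_open_Int[OF top_Y U(1) V_open[OF m(1)]] .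
    then obtain z where z: "z \<in> elems (pts X)" "app h z \<in> U" "app h z \<in> elems (app V m)"
      by (rule dense[of _ p]) (use U(2) pV m(1) in auto)
    then have kz: "app k (app h z) = app s m" using U(3) r kX(2) by simp
    from exit_or_stay[of "app h z"] show False
    proof
      assume "\<forall>i\<in>elems omega. app h z \<in> elems (app V i)"
      then show False using k_stay[of "app h z"] z(1) kz s_nonzero[OF m(1)] by simp
    next
      assume "\<exists>l\<in>elems omega. app h z \<notin> elems (app V l) \<and> (\<forall>i\<in>elems l. app h z \<in> elems (app V i))"
      then obtain l where l: "l \<in> elems omega" "app h z \<notin> elems (app V l)" "\<forall>i\<in>elems l. app h z \<in> elems (app V i)"
        by blast
      then have eq: "app s l = app s m" using k_exit[of "app h z" l] z(1) kz by simp
      from omega_trichotomy[OF l(1) m(1)] have "l = m"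
        using s_inj[OF m(1), of l] s_inj[OF l(1), of m] eq by metis
      then show False using l(2) z(3) by simp
    qed
  qed
  have "U \<subseteq> elems (app g n)" if n: "n \<in> elems omega" for n
  proof -
    have "U \<subseteq> elems (app V n)"
    proof
      fix y assume "y \<in> U"
      show "y \<in> elems (app V n)"
      proof (rule ccontr)
        assume "y \<notin> elems (app V n)"
        then have "y \<in> U \<inter> (elems (pts Y) - elems (app V n))"
          using \<open>y \<in> U\<close> is_open_subset[OF top_Y U(1)] by blast
        moreover have "is_open Y (U \<inter> (elems (pts Y) - elems (app V n)))"
          using is_open_Int[OF top_Y U(1)] V_clopen[OF n] unfolding clopen_def by blast
        ultimately obtain x where "x \<in> elems (pts X)" "app h x \<in> U" "app h x \<notin> elems (app V n)"
          using dense by blast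
        then show False using in_V n by blast
      qed
    qed
    then show ?thesis using Vg[OF n] by blast
  qed
  then show thesis using that U by blast
qed

lemma P_space_Y:
  assumes CMC
  shows "P_space Y"
  unfolding P_space_def
proof (intro conjI top_Y equalityI subsetI)
  fix A assume "A \<in> {A. G_delta Y A}"
  then obtain g where g: "g \<in> funs omega (opens Y)" "elems A = (\<Inter>n\<in>elems omega. elems (app g n))"
    unfolding G_delta_def by blast
  have "is_open Y (elems A)"
  proof (rule is_openI[OF top_Y is_set_elems])
    fix p assume "p \<in> elems A"
    then have "p \<in> elems (app g n)" if "n \<in> elems omega" for n using g(2) that by blast
    then show "\<exists>U. is_open Y U \<and> p \<in> U \<and> U \<subseteq> elems A"
      using G_delta_interior[OF \<open>CMC\<close> g(1)] unfolding g(2) by (metis INF_greatest)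
  qed
  then show "A \<in> elems (opens Y)" by (simp add: is_open_elems)
next
  fix A assume A: "A \<in> elems (opens Y)"
  have "G_delta Y A"
  proof (rule G_deltaI)
    show "definable (\<lambda>e. e 0 \<in> elems A)" by (intro definable_intros)
    have "elems A \<subseteq> elems (pts Y)" using A is_open_subset[OF top_Y] by (simp add: is_open_elems)
    then have eq: "{x\<in>elems (pts Y). x \<in> elems A} = elems A" by blast
    then show "elems A = {x\<in>elems (pts Y). \<forall>n\<in>elems omega. x \<in> elems A}"
      using zero_in_omega by blast
    show "is_open Y {x\<in>elems (pts Y). x \<in> elems A}" using A by (simp only: eq is_open_elems)
  qed
  then show "A \<in> {A. G_delta Y A}" by simp
qed

end

theorem theorem4p7:
  fixes mem :: "'v \<Rightarrow> 'v \<Rightarrow> bool"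
    and \<R> :: "'v ofield"
    and E X :: "'v space"
  assumes "ZF mem"
    and "set_universe.real_numbers mem \<R>"
    and "set_universe.Tychonoff mem \<R> E"
    and "set_universe.E_compact mem E (set_universe.discrete mem (fcarrier \<R>))"
    and "set_universe.E_completely_regular mem E X"
    and "set_universe.P_space mem X"
  shows "set_universe.CMC mem \<longrightarrow>
    (\<forall>Y h. set_universe.Hewitt_extension mem E X Y h \<longrightarrow> set_universe.P_space mem Y)"
proof (intro impI allI)
  fix Y h
  assume "set_universe.CMC mem" and "set_universe.Hewitt_extension mem E X Y h"
  then interpret Hewitt_P mem \<R> E X Y h
    using assms by (intro Hewitt_P.intro ZF_reals.intro ZF_reals_axioms.intro Hewitt_P_axioms.intro)
  show "set_universe.P_space mem Y"
    using P_space_Y \<open>set_universe.CMC mem\<close> .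
qed

end
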